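(* For a simplicial complex $\mathcal K$ on the vertex set $[m]$, the following conditions are equivalent: (a) all full subcomplexes $\mathcal K_I$, $\varnothing\ne I\subset[m]$, of $\mathcal K$ are acyclic; (b) $\mathcal K=\Delta^{m-1}$ (the full simplex on $[m]$) and $\mathcal Z_{\mathcal K}=(D^2)^m$; (c) $\mathcal Z_{\mathcal K}$ is acyclic; (d) $\mathit{HH}^*(\mathcal Z_{\mathcal K})=\mathit{HH}^{0,0}(\mathcal Z_{\mathcal K})=\mathbb Z$.
   Context: A simplicial complex $\mathcal K$ on the vertex set $[m]=\{1,\dots,m\}$, $m\ge1$, is a collection of subsets of $[m]$ closed under passing to subsets and containing $\varnothing$ and all singletons. For $I\subset[m]$ the full subcomplex is $\mathcal K_I=\{J\in\mathcal K: J\subset I\}$. All (co)homology has $\mathbb Z$ coefficients; acyclic means having trivial reduced (co)homology; $\widetilde H^*$ is reduced simplicial cohomology, with $\widetilde H^{-1}(\mathcal K_\varnothing)=\mathbb Z$. Moment-angle complex: $\mathcal Z_{\mathcal K}=\bigcup_{I\in\mathcal K}\{z\in(D^2)^m: |z_j|=1\text{ if }j\notin I\}$. Its cohomology has the bigraded Hochster decomposition $H^{-k,2\ell}(\mathcal Z_{\mathcal K})=\bigoplus_{I\subset[m],|I|=\ell}\widetilde H^{\ell-k-1}(\mathcal K_I)$, of total degree $-k+2\ell$. Double cohomology: for $i\in I$ let $\psi_{p;i,I}:\widetilde H^p(\mathcal K_I)\to\widetilde H^p(\mathcal K_{I\setminus\{i\}})$ be induced by inclusion, let $\varepsilon(i,I)=(-1)^{\#\{r\in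 I: r<i\}}$, and define $d'$ on $\widetilde H^p(\mathcal K_I)$ by $d'=(-1)^{p+1}\sum_{i\in I}\varepsilon(i,I)\psi_{p;i,I}$. Then $d':H^{-k,2\ell}(\mathcal Z_{\mathcal K})\to H^{-k+1,2\ell-2}(\mathcal Z_{\mathcal K})$, $(d')^2=0$, and $\mathit{HH}^{-k,2\ell}(\mathcal Z_{\mathcal K})$ denotes the cohomology of $(H^*(\mathcal Z_{\mathcal K}),d')$ at bidegree $(-k,2\ell)$; $\mathit{HH}^*$ is the sum of all bigraded components. *)

theory Defs
  imports "HOL-Homology.Homology" "HOL-Algebra.Product_Groups"
begin

definition simplicial_complex :: "nat \<Rightarrow> nat set set \<Rightarrow> bool" where
  "simplicial_complex m K \<longleftrightarrow>
     K \<subseteq> Pow {1..m} \<and> (\<forall>J\<in>K. \<forall>I. I \<subseteq> J \<longrightarrow> I \<in> K) \<and> {} \<in> K \<and> (\<forall>i\<in>{1..m}. {i} \<in> K)"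

definition full_subcomplex :: "nat set set \<Rightarrow> nat set \<Rightarrow> nat set set" where
  "full_subcomplex K I = {J \<in> K. J \<subseteq> I}"

text \<open>The homology at \<open>B\<close> of \<open>A \<rightarrow> B \<rightarrow> C\<close>, with maps \<open>f\<close> and \<open>g\<close> such that \<open>g \<circ> f\<close> is trivial.\<close>

definition homology_at ::
  "[('a, 'm) monoid_scheme, 'a \<Rightarrow> 'b, ('b, 'n) monoid_scheme, 'b \<Rightarrow> 'c, ('c, 'k) monoid_scheme]
     \<Rightarrow> 'b set monoid" where
  "homology_at A f B g C = subgroup_generated B (kernel B C g) Mod (f ` carrier A)"

definition vertex_sign :: "nat \<Rightarrow> nat set \<Rightarrow> int" where
  "vertex_sign i I = (-1) ^ card {r \<in> I. r < i}"

text \<open>Dimensions are integers: \<open>faces K (-1) = {{}}\<close> is the augmentation degree, and there are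
  no faces in dimensions below.  Simplices are oriented by the order of \<open>nat\<close>, so a cochain is
  an integer-valued function on the faces.\<close>

definition faces :: "nat set set \<Rightarrow> int \<Rightarrow> nat set set" where
  "faces K p = {J \<in> K. int (card J) = p + 1}"

definition cochain_group :: "nat set set \<Rightarrow> int \<Rightarrow> (nat set \<Rightarrow> int) monoid" where
  "cochain_group K p = product_group (faces K p) (\<lambda>_. integer_group)"

definition coboundary :: "nat set set \<Rightarrow> int \<Rightarrow> (nat set \<Rightarrow> int) \<Rightarrow> nat set \<Rightarrow> int" where
  "coboundary K p f = (\<lambda>J\<in>faces K (p + 1). \<Sum>j\<in>J. vertex_sign j J * f (J - {j}))"

definition reduced_cohomology_group :: "nat set set \<Rightarrow> int \<Rightarrow> (nat set \<Rightarrow> int) set monoid" where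
  "reduced_cohomology_group K p =
     homology_at (cochain_group K (p - 1)) (coboundary K (p - 1))
                 (cochain_group K p) (coboundary K p) (cochain_group K (p + 1))"

definition acyclic_complex :: "nat set set \<Rightarrow> bool" where
  "acyclic_complex K \<longleftrightarrow> (\<forall>p. trivial_group (reduced_cohomology_group K p))"

text \<open>The map in cohomology induced by the inclusion of a subcomplex \<open>L\<close>.  A class is a coset of
  cocycles; restricting its members to \<open>L\<close> and adding the coboundaries of \<open>L\<close> gives the coset of
  the restricted cocycles.\<close>

definition cohomology_restrict ::
  "nat set set \<Rightarrow> int \<Rightarrow> (nat set \<Rightarrow> int) set \<Rightarrow> (nat set \<Rightarrow> int) set" where
  "cohomology_restrict L p c =
     (coboundary L (p - 1) ` carrier (cochain_group L (p - 1)))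
       <#>\<^bsub>cochain_group L p\<^esub> ((\<lambda>f. restrict f (faces L p)) ` c)"

definition moment_angle_set :: "nat \<Rightarrow> nat set set \<Rightarrow> (nat \<Rightarrow> complex) set" where
  "moment_angle_set m K =
     (\<Union>I\<in>K. {z \<in> {1..m} \<rightarrow>\<^sub>E cball 0 1. \<forall>j\<in>{1..m} - I. norm (z j) = 1})"

definition moment_angle_complex :: "nat \<Rightarrow> nat set set \<Rightarrow> (nat \<Rightarrow> complex) topology" where
  "moment_angle_complex m K =
     subtopology (product_topology (\<lambda>_. euclidean) {1..m}) (moment_angle_set m K)"

text \<open>The library's reduced homology starts in degree 0 and so is trivial for the empty space,
  whose reduced homology in degree \<open>-1\<close> is not; hence the first conjunct.\<close>

definition acyclic_space :: "'a topology \<Rightarrow> bool" where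
  "acyclic_space X \<longleftrightarrow> topspace X \<noteq> {} \<and> (\<forall>p. trivial_group (reduced_homology_group p X))"

text \<open>\<open>bigraded_cohomology m K k l\<close> is the component of bidegree \<open>(-k, 2 * l)\<close> of the cohomology of
  the moment-angle complex, given by its Hochster decomposition.  Both \<open>k\<close> and \<open>l\<close> range over the
  integers; the group is trivial where the index set is empty or the dimension out of range.\<close>

definition bigraded_cohomology ::
  "nat \<Rightarrow> nat set set \<Rightarrow> int \<Rightarrow> int \<Rightarrow> (nat set \<Rightarrow> (nat set \<Rightarrow> int) set) monoid" where
  "bigraded_cohomology m K k l =
     sum_group {I. I \<subseteq> {1..m} \<and> int (card I) = l}
       (\<lambda>I. reduced_cohomology_group (full_subcomplex K I) (l - k - 1))"

text \<open>The component at \<open>I\<close> of \<open>d' x\<close> collects the terms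
  \<open>(-1) ^ (p + 1) * \<epsilon> (i, I') * \<psi> (p; i, I') (x I')\<close> over all \<open>I'\<close> and \<open>i \<in> I'\<close> with \<open>I' - {i} = I\<close>.
  The groups are written multiplicatively, and \<open>p = l - k - 1\<close>.\<close>

definition double_differential ::
  "nat \<Rightarrow> nat set set \<Rightarrow> int \<Rightarrow> int \<Rightarrow>
     (nat set \<Rightarrow> (nat set \<Rightarrow> int) set) \<Rightarrow> nat set \<Rightarrow> (nat set \<Rightarrow> int) set" where
  "double_differential m K k l x =
     (\<lambda>I\<in>{I. I \<subseteq> {1..m} \<and> int (card I) = l - 1}.
        let p = l - k - 1; L = full_subcomplex K I; H = reduced_cohomology_group L p in
        finprod H
          (\<lambda>i. cohomology_restrict L p (x (insert i I))
                 [^]\<^bsub>H\<^esub> ((if even (p + 1) then 1 else - 1) * vertex_sign i (insert i I)))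
          ({1..m} - I))"

text \<open>The component of bidegree \<open>(-k, 2 * l)\<close>; the differential lowers both \<open>k\<close> and \<open>l\<close> by one.\<close>

definition double_cohomology ::
  "nat \<Rightarrow> nat set set \<Rightarrow> int \<Rightarrow> int \<Rightarrow> (nat set \<Rightarrow> (nat set \<Rightarrow> int) set) set monoid" where
  "double_cohomology m K k l =
     homology_at (bigraded_cohomology m K (k + 1) (l + 1)) (double_differential m K (k + 1) (l + 1))
                 (bigraded_cohomology m K k l) (double_differential m K k l)
                 (bigraded_cohomology m K (k - 1) (l - 1))"

end

theory Submission
  imports Defs
begin

text \<open>
  Every condition is compared with the statement that \<open>K\<close> is the full simplex on \<open>{1..m}\<close>; the
  equality of spaces in (b) is then automatic.

  \<^item> A nonempty full subcomplex of a simplex is a simplex, hence a cone over its least vertex, and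
  coning off gives a contracting homotopy of the augmented cochain complex (\<open>acyclic_simplex\<close>).
  So (b) implies (a).

  \<^item> If all \<open>K\<^sub>I\<close> with \<open>I \<noteq> {}\<close> are acyclic, the Hochster decomposition leaves only
  the summand \<open>I = {}\<close>, a copy of the integers in bidegree \<open>(0, 0)\<close>, and no differential can
  change it (\<open>double_cohomology_of_acyclic\<close>).  So (a) implies (d).

  \<^item> For (d) implies (b), consider the double complex of the cochains of all \<open>K\<^sub>I\<close>, with the simplicial
  coboundary \<open>d\<close> and with the map \<open>d'\<close> that deletes a vertex from \<open>I\<close>; then \<open>d'\<close> is the
  differential induced on the \<open>d\<close>-cohomology, up to a sign.  Let \<open>y\<^sub>n\<close> be the indicator
  function of the face \<open>{1..n-1}\<close> in the full subcomplex on \<open>{1..n}\<close>.  Then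
  \<open>d' y\<^sub>1\<close> is the generator \<open>g\<close> of the cochains on \<open>I = {}\<close>, and
  \<open>d' y\<^sub>n\<^sub>+\<^sub>1 = - d y\<^sub>n\<close>.  If \<open>{1..m}\<close> is not a face, then \<open>d y\<^sub>m = 0\<close>, so \<open>y\<^sub>m\<close> is a
  family of cocycles whose class is killed by \<open>d'\<close>.  Vanishing of the double cohomology in
  bidegrees \<open>(-1, 2 l)\<close> permits a zig-zag down this staircase: a cocycle
  \<open>y\<^sub>n\<^sub>+\<^sub>1 + d' v\<close> is \<open>d' w + d u\<close> with \<open>w\<close> a family of cocycles, and then \<open>y\<^sub>n + d' u\<close> is
  again a cocycle (\<open>correctable_step\<close>).  At the bottom, \<open>y\<^sub>1 + d' v\<close> is a family of cocycles in
  dimension \<open>-1\<close> on one-point complexes, so it is zero; but \<open>d'\<close> maps it to \<open>g\<close>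
  (\<open>not_correctable_one\<close>).  In the language of spectral sequences: the total complex is acyclic if
  \<open>K\<close> is not a simplex, so the class \<open>g\<close> cannot be the only one on the second page.

  \<^item> The moment-angle complex of a simplex is a polydisc, hence contractible, so (b) implies (c).
  Conversely, if \<open>I\<close> is a minimal non-face, then projecting the moment-angle complex to the
  coordinates in \<open>I\<close> retracts it onto the boundary of a polydisc, which is a sphere of dimension
  \<open>2 |I| - 1\<close> and carries nontrivial homology
  (\<open>retraction_map_moment_angle_complex_nsphere\<close>).  So (c) implies (b).
\<close>

section \<open>Cochains and alternating signs\<close>

definition finite_complex :: "nat set set \<Rightarrow> bool" where
  "finite_complex L \<longleftrightarrow> (\<forall>J\<in>L. finite J \<and> Pow J \<subseteq> L)"

text \<open>The coboundary without its restriction to the faces.  Formulas for total functions hold without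
  side conditions on faces; the extensional cochains of \<open>cochain_group\<close> enter only
  through cohomology classes.\<close>

definition delta :: "(nat set \<Rightarrow> int) \<Rightarrow> nat set \<Rightarrow> int" where
  "delta f J = (\<Sum>j\<in>J. vertex_sign j J * f (J - {j}))"

lemma delta_add: "delta (\<lambda>J. f J + g J) J = delta f J + delta g J"
  by (simp add: delta_def distrib_left sum.distrib)

lemma delta_scale: "delta (\<lambda>J. c * f J) J = c * delta f J"
  by (simp add: delta_def sum_distrib_left mult.left_commute)

lemma delta_diff: "delta (\<lambda>J. f J - g J) J = delta f J - delta g J"
  by (simp add: delta_def right_diff_distrib sum_subtractf)

lemma delta_zero [simp]: "delta (\<lambda>J. 0) J = 0"
  by (simp add: delta_def)

lemma delta_sum: "delta (\<lambda>J. \<Sum>i\<in>A. c i * f i J) J = (\<Sum>i\<in>A. c i * delta (f i) J)"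
  unfolding delta_def sum_distrib_left
  by (subst sum.swap) (simp add: mult.left_commute)

text \<open>Removing the smaller of two vertices changes the position of the larger one, but not conversely.
  This is the common source of \<open>d\<^sup>2 = 0\<close> (\<open>delta_delta\<close>) and \<open>d'\<^sup>2 = 0\<close>
  (\<open>vertex_deletion_twice\<close>).\<close>

lemma vertex_sign_swap:
  assumes "finite T" "i \<in> T" "j \<in> T" "i \<noteq> j"
  shows "vertex_sign i (T - {j}) * vertex_sign j T = - (vertex_sign j (T - {i}) * vertex_sign i T)"
proof -
  have *: "vertex_sign i (T - {j}) * vertex_sign j T = - (vertex_sign j (T - {i}) * vertex_sign i T)"
    if "i \<in> T" "j \<in> T" "i < j" for i j
  proof -
    have "{r \<in> T - {j}. r < i} = {r \<in> T. r < i}"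
      using that by auto
    moreover have "{r \<in> T. r < j} = insert i {r \<in> T - {i}. r < j}"
      using that by auto
    moreover have "finite {r \<in> T - {i}. r < j}"
      by (rule finite_subset[of _ T]) (use assms in auto)
    ultimately show ?thesis
      by (simp add: vertex_sign_def)
  qed
  show ?thesis
    using assms *[of i j] *[of j i] by (cases "i < j") auto
qed

lemma sum_antisymmetric_offdiagonal:
  fixes F :: "nat \<Rightarrow> nat \<Rightarrow> int"
  assumes "finite A" and "\<And>i j. i \<in> A \<Longrightarrow> j \<in> A \<Longrightarrow> i \<noteq> j \<Longrightarrow> F i j = - F j i"
  shows "(\<Sum>i\<in>A. \<Sum>j\<in>A - {i}. F i j) = 0"
proof -
  define G where "G i j = (if i = j then 0 else F i j)" for i j
  have "(\<Sum>j\<in>A - {i}. F i j) = (\<Sum>j\<in>A. G i j)" for i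
    using assms(1) by (rule sum.mono_neutral_cong_left) (auto simp: G_def)
  then have eq: "(\<Sum>i\<in>A. \<Sum>j\<in>A - {i}. F i j) = (\<Sum>i\<in>A. \<Sum>j\<in>A. G i j)"
    by simp
  have "(\<Sum>i\<in>A. \<Sum>j\<in>A. G i j) = (\<Sum>j\<in>A. \<Sum>i\<in>A. G i j)"
    by (rule sum.swap)
  also have "\<dots> = - (\<Sum>i\<in>A. \<Sum>j\<in>A. G i j)"
  proof -
    have "G i j = - G j i" if "i \<in> A" "j \<in> A" for i j
      unfolding G_def using assms(2)[OF that] by (cases "i = j") auto
    then show ?thesis
      unfolding sum_negf[symmetric] by (intro sum.cong refl)
  qed
  finally show ?thesis
    unfolding eq by linarith
qed

lemma delta_delta:
  assumes "finite J"
  shows "delta (delta f) J = 0"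
proof -
  have "delta (delta f) J
      = (\<Sum>j\<in>J. \<Sum>i\<in>J - {j}. vertex_sign j J * (vertex_sign i (J - {j}) * f (J - {j} - {i})))"
    by (simp add: delta_def sum_distrib_left)
  also have "\<dots> = 0"
  proof (rule sum_antisymmetric_offdiagonal[OF assms])
    fix j i assume ij: "j \<in> J" "i \<in> J" "j \<noteq> i"
    have swap: "J - {j} - {i} = J - {i} - {j}" by auto
    have sign: "vertex_sign j J * vertex_sign i (J - {j}) = - (vertex_sign i J * vertex_sign j (J - {i}))"
      using vertex_sign_swap[OF assms ij(2,1)] ij(3) by (simp only: mult.commute not_sym)
    show "vertex_sign j J * (vertex_sign i (J - {j}) * f (J - {j} - {i}))
        = - (vertex_sign i J * (vertex_sign j (J - {i}) * f (J - {i} - {j})))"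
      unfolding swap mult.assoc[symmetric] sign by simp
  qed
  finally show ?thesis .
qed

lemma faces_remove:
  assumes "finite_complex L" "J \<in> faces L (p + 1)" "j \<in> J"
  shows "J - {j} \<in> faces L p"
proof -
  have "finite J" "J - {j} \<in> L" "int (card J) = p + 2"
    using assms by (auto simp: finite_complex_def faces_def)
  then show ?thesis
    using card_Suc_Diff1[of J j] assms(3) by (simp add: faces_def)
qed

lemma faces_finite: "finite_complex L \<Longrightarrow> J \<in> faces L p \<Longrightarrow> finite J"
  by (auto simp: finite_complex_def faces_def)

lemma delta_cong_faces:
  assumes "finite_complex L" "J \<in> faces L (p + 1)" "\<And>J'. J' \<in> faces L p \<Longrightarrow> f J' = g J'"
  shows "delta f J = delta g J"
  unfolding delta_def using assms(3) faces_remove[OF assms(1,2)] by (intro sum.cong refl) auto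

lemma coboundary_eq: "coboundary L p f = restrict (delta f) (faces L (p + 1))"
  by (simp add: coboundary_def delta_def[abs_def])

lemma carrier_cochain_group [simp]: "carrier (cochain_group L p) = extensional (faces L p)"
  by (auto simp: cochain_group_def PiE_def)

lemma one_cochain_group [simp]: "\<one>\<^bsub>cochain_group L p\<^esub> = (\<lambda>J\<in>faces L p. 0)"
  by (simp add: cochain_group_def)

lemma mult_cochain_group [simp]:
  "f \<otimes>\<^bsub>cochain_group L p\<^esub> g = (\<lambda>J\<in>faces L p. f J + g J)"
  by (simp add: cochain_group_def)

lemma comm_group_cochain_group: "comm_group (cochain_group L p)"
  by (rule group.group_comm_groupI) (auto simp: cochain_group_def add.commute)

lemma coboundary_hom:
  assumes "finite_complex L"
  shows "coboundary L p \<in> hom (cochain_group L p) (cochain_group L (p + 1))"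
proof (rule homI)
  fix f g :: "nat set \<Rightarrow> int"
  have "delta (\<lambda>J\<in>faces L p. f J + g J) J = delta f J + delta g J" if "J \<in> faces L (p + 1)" for J
    using delta_cong_faces[OF assms that, of "\<lambda>J\<in>faces L p. f J + g J" "\<lambda>J. f J + g J"]
    by (simp add: delta_add)
  then show "coboundary L p (f \<otimes>\<^bsub>cochain_group L p\<^esub> g)
      = coboundary L p f \<otimes>\<^bsub>cochain_group L (p + 1)\<^esub> coboundary L p g"
    by (auto simp: coboundary_eq fun_eq_iff)
qed (auto simp: coboundary_eq)

section \<open>Reduced cohomology by representatives\<close>

definition cocycle :: "nat set set \<Rightarrow> int \<Rightarrow> (nat set \<Rightarrow> int) \<Rightarrow> bool" where
  "cocycle L p f \<longleftrightarrow> (\<forall>J\<in>faces L (p + 1). delta f J = 0)"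

abbreviation cocycle_group :: "nat set set \<Rightarrow> int \<Rightarrow> (nat set \<Rightarrow> int) monoid" where
  "cocycle_group L p \<equiv> subgroup_generated (cochain_group L p)
     (kernel (cochain_group L p) (cochain_group L (p + 1)) (coboundary L p))"

lemma coboundary_group_hom:
  "finite_complex L \<Longrightarrow> group_hom (cochain_group L p) (cochain_group L (p + 1)) (coboundary L p)"
  by (auto simp: group_hom_def group_hom_axioms_def coboundary_hom comm_group.axioms(2) comm_group_cochain_group)

lemma carrier_cocycle_group:
  assumes "finite_complex L"
  shows "carrier (cocycle_group L p) = {f \<in> extensional (faces L p). cocycle L p f}"
proof -
  have "carrier (cocycle_group L p) = kernel (cochain_group L p) (cochain_group L (p + 1)) (coboundary L p)"
    using subgroup.carrier_subgroup_generated_subgroup[OF group_hom.subgroup_kernel[OF coboundary_group_hom[OF assms]]] .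
  then show ?thesis
    by (auto simp: kernel_def coboundary_eq cocycle_def fun_eq_iff restrict_def)
qed

text \<open>The coset of \<open>f\<close>, described by its elements (see \<open>r_coset_cohomology_class\<close>).  The function \<open>f\<close> is
  total and only its values on faces matter, so that representatives can be added and scaled pointwise.\<close>

definition cohomology_class :: "nat set set \<Rightarrow> int \<Rightarrow> (nat set \<Rightarrow> int) \<Rightarrow> (nat set \<Rightarrow> int) set" where
  "cohomology_class L p f =
     {g \<in> extensional (faces L p). \<exists>u. \<forall>J\<in>faces L p. g J = delta u J + f J}"

lemma coboundaries_eq:
  assumes "finite_complex L"
  shows "coboundary L (p - 1) ` carrier (cochain_group L (p - 1)) = cohomology_class L p (\<lambda>_. 0)"
proof (intro equalityI subsetI)
  fix g assume "g \<in> cohomology_class L p (\<lambda>_. 0)"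
  then obtain u where g: "g \<in> extensional (faces L p)" "\<And>J. J \<in> faces L p \<Longrightarrow> g J = delta u J"
    by (auto simp: cohomology_class_def)
  have "g = coboundary L (p - 1) (restrict u (faces L (p - 1)))"
  proof (rule extensionalityI[OF g(1)])
    fix J assume J: "J \<in> faces L p"
    then show "g J = coboundary L (p - 1) (restrict u (faces L (p - 1))) J"
      using delta_cong_faces[OF assms, of J "p - 1" u "restrict u (faces L (p - 1))"] g(2)
      by (simp add: coboundary_eq)
  qed (simp add: coboundary_eq)
  then show "g \<in> coboundary L (p - 1) ` carrier (cochain_group L (p - 1))"
    by auto
qed (auto simp: coboundary_eq cohomology_class_def)

lemma subgroup_coboundaries:
  assumes "finite_complex L"
  shows "subgroup (coboundary L (p - 1) ` carrier (cochain_group L (p - 1))) (cocycle_group L p)"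
proof -
  interpret C: comm_group "cochain_group L p" by (rule comm_group_cochain_group)
  have "subgroup (coboundary L (p - 1) ` carrier (cochain_group L (p - 1))) (cochain_group L p)"
    using group_hom.img_is_subgroup[OF coboundary_group_hom[OF assms, of "p - 1"]] by simp
  moreover have "coboundary L (p - 1) ` carrier (cochain_group L (p - 1)) \<subseteq> carrier (cocycle_group L p)"
  proof -
    have "delta f J = 0" if "\<And>J. J \<in> faces L p \<Longrightarrow> f J = delta u J" "J \<in> faces L (p + 1)" for f u J
      using delta_cong_faces[OF assms that(2), of f "delta u"] that(1) delta_delta[OF faces_finite[OF assms that(2)], of u] by simp
    then show ?thesis
      unfolding coboundaries_eq[OF assms] carrier_cocycle_group[OF assms]
      by (auto simp: cohomology_class_def cocycle_def)
  qed
  ultimately show ?thesis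
    by (simp add: C.subgroup_subgroup_generated_iff)
qed

lemma reduced_cohomology_group_eq:
  "reduced_cohomology_group L p
     = cocycle_group L p Mod (coboundary L (p - 1) ` carrier (cochain_group L (p - 1)))"
  by (simp add: reduced_cohomology_group_def homology_at_def)

lemma comm_group_reduced_cohomology_group:
  assumes "finite_complex L"
  shows "comm_group (reduced_cohomology_group L p)"
proof -
  interpret C: comm_group "cochain_group L p" by (rule comm_group_cochain_group)
  have "comm_group (cocycle_group L p)"
    by (rule C.abelian_subgroup_generated) (rule comm_group_cochain_group)
  from comm_group.abelian_FactGroup[OF this subgroup_coboundaries[OF assms]] show ?thesis
    unfolding reduced_cohomology_group_eq .
qed

lemma r_coset_cohomology_class:
  assumes "finite_complex L"
  shows "cohomology_class L p (\<lambda>_. 0) #>\<^bsub>cocycle_group L p\<^esub> f = cohomology_class L p f"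
proof (intro equalityI subsetI)
  fix g assume "g \<in> cohomology_class L p f"
  then obtain u where g: "g \<in> extensional (faces L p)" "\<And>J. J \<in> faces L p \<Longrightarrow> g J = delta u J + f J"
    by (auto simp: cohomology_class_def)
  have "g = (restrict (delta u) (faces L p)) \<otimes>\<^bsub>cocycle_group L p\<^esub> f"
    using g by (auto simp: fun_eq_iff extensional_def)
  moreover have "restrict (delta u) (faces L p) \<in> cohomology_class L p (\<lambda>_. 0)"
    by (auto simp: cohomology_class_def)
  ultimately show "g \<in> cohomology_class L p (\<lambda>_. 0) #>\<^bsub>cocycle_group L p\<^esub> f"
    unfolding r_coset_def by blast
qed (auto simp: cohomology_class_def r_coset_def)

lemma cohomology_class_restrict [simp]:
  "cohomology_class L p (restrict f (faces L p)) = cohomology_class L p f"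
  by (simp add: cohomology_class_def)

lemma carrier_reduced_cohomology_group:
  assumes "finite_complex L"
  shows "carrier (reduced_cohomology_group L p) = {cohomology_class L p f |f. cocycle L p f}"
proof -
  have "carrier (reduced_cohomology_group L p)
      = cohomology_class L p ` {f \<in> extensional (faces L p). cocycle L p f}"
    using assms by (simp add: reduced_cohomology_group_eq carrier_FactGroup coboundaries_eq
        r_coset_cohomology_class carrier_cocycle_group del: mult_subgroup_generated carrier_cochain_group)
  also have "\<dots> = {cohomology_class L p f |f. cocycle L p f}"
  proof -
    have "cocycle L p (restrict f (faces L p))" if "cocycle L p f" for f
      using that delta_cong_faces[OF assms, of _ p "restrict f (faces L p)" f] by (simp add: cocycle_def)
    then have "\<exists>g \<in> {f \<in> extensional (faces L p). cocycle L p f}. cohomology_class L p f = cohomology_class L p g"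
      if "cocycle L p f" for f
      using that by (intro bexI[of _ "restrict f (faces L p)"]) auto
    then show ?thesis
      by blast
  qed
  finally show ?thesis .
qed

lemma one_reduced_cohomology_group:
  "finite_complex L \<Longrightarrow> \<one>\<^bsub>reduced_cohomology_group L p\<^esub> = cohomology_class L p (\<lambda>_. 0)"
  by (simp add: reduced_cohomology_group_eq coboundaries_eq del: carrier_cochain_group)

lemma set_mult_cohomology_class:
  "cohomology_class L p f <#>\<^bsub>cochain_group L p\<^esub> cohomology_class L p g
     = cohomology_class L p (\<lambda>J. f J + g J)"
proof (intro equalityI subsetI)
  fix h assume "h \<in> cohomology_class L p f <#>\<^bsub>cochain_group L p\<^esub> cohomology_class L p g"
  then obtain a b u v where "h = (\<lambda>J\<in>faces L p. a J + b J)"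
    "\<And>J. J \<in> faces L p \<Longrightarrow> a J = delta u J + f J" "\<And>J. J \<in> faces L p \<Longrightarrow> b J = delta v J + g J"
    by (auto simp: set_mult_def cohomology_class_def)
  then show "h \<in> cohomology_class L p (\<lambda>J. f J + g J)"
    by (auto simp: cohomology_class_def delta_add intro!: exI[of _ "\<lambda>J. u J + v J"])
next
  fix h assume "h \<in> cohomology_class L p (\<lambda>J. f J + g J)"
  then obtain u where h: "h \<in> extensional (faces L p)"
    "\<And>J. J \<in> faces L p \<Longrightarrow> h J = delta u J + (f J + g J)"
    by (auto simp: cohomology_class_def)
  have "h = restrict (\<lambda>J. delta u J + f J) (faces L p) \<otimes>\<^bsub>cochain_group L p\<^esub> restrict g (faces L p)"
    using h by (auto simp: fun_eq_iff extensional_def)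
  moreover have "restrict (\<lambda>J. delta u J + f J) (faces L p) \<in> cohomology_class L p f"
    by (auto simp: cohomology_class_def)
  moreover have "restrict g (faces L p) \<in> cohomology_class L p g"
    by (auto simp: cohomology_class_def intro: exI[of _ "\<lambda>_. 0"])
  ultimately show "h \<in> cohomology_class L p f <#>\<^bsub>cochain_group L p\<^esub> cohomology_class L p g"
    unfolding set_mult_def by blast
qed

lemma mult_reduced_cohomology_group:
  "cohomology_class L p f \<otimes>\<^bsub>reduced_cohomology_group L p\<^esub> cohomology_class L p g
     = cohomology_class L p (\<lambda>J. f J + g J)"
  using set_mult_cohomology_class[of L p f g]
  by (simp add: reduced_cohomology_group_eq set_mult_def)

lemma cohomology_class_eq_iff:
  "cohomology_class L p f = cohomology_class L p g
     \<longleftrightarrow> (\<exists>u. \<forall>J\<in>faces L p. f J = g J + delta u J)" (is "?l \<longleftrightarrow> ?r")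
proof
  assume ?l
  moreover have "restrict f (faces L p) \<in> cohomology_class L p f"
    by (auto simp: cohomology_class_def intro: exI[of _ "\<lambda>_. 0"])
  ultimately show ?r
    by (auto simp: cohomology_class_def add.commute)
next
  assume ?r
  then obtain u where u: "\<And>J. J \<in> faces L p \<Longrightarrow> f J = g J + delta u J" by blast
  show ?l
  proof (intro equalityI subsetI)
    fix h assume "h \<in> cohomology_class L p f"
    then obtain v where "h \<in> extensional (faces L p)" "\<And>J. J \<in> faces L p \<Longrightarrow> h J = delta v J + f J"
      by (auto simp: cohomology_class_def)
    then show "h \<in> cohomology_class L p g"
      using u by (auto simp: cohomology_class_def delta_add intro!: exI[of _ "\<lambda>J. v J + u J"])
  next
    fix h assume "h \<in> cohomology_class L p g"
    then obtain v where "h \<in> extensional (faces L p)" "\<And>J. J \<in> faces L p \<Longrightarrow> h J = delta v J + g J"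
      by (auto simp: cohomology_class_def)
    then show "h \<in> cohomology_class L p f"
      using u by (auto simp: cohomology_class_def delta_diff intro!: exI[of _ "\<lambda>J. v J - u J"])
  qed
qed

lemma cocycle_scale: "cocycle L p f \<Longrightarrow> cocycle L p (\<lambda>J. c * f J)"
  by (simp add: cocycle_def delta_scale)

lemma cocycle_sum: "(\<And>i. i \<in> A \<Longrightarrow> cocycle L p (f i)) \<Longrightarrow> cocycle L p (\<lambda>J. \<Sum>i\<in>A. c i * f i J)"
  by (simp add: cocycle_def delta_sum)

lemma cocycle_zero [simp]: "cocycle L p (\<lambda>_. 0)"
  by (simp add: cocycle_def)

lemma class_in_reduced_cohomology_group:
  "finite_complex L \<Longrightarrow> cocycle L p f \<Longrightarrow> cohomology_class L p f \<in> carrier (reduced_cohomology_group L p)"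
  by (auto simp: carrier_reduced_cohomology_group)

lemma int_pow_reduced_cohomology_group:
  assumes "finite_complex L" "cocycle L p f"
  shows "cohomology_class L p f [^]\<^bsub>reduced_cohomology_group L p\<^esub> (n::int) = cohomology_class L p (\<lambda>J. n * f J)"
proof -
  have hom: "(\<lambda>n. cohomology_class L p (\<lambda>J. n * f J)) \<in> hom integer_group (reduced_cohomology_group L p)"
    by (rule homI) (auto simp: mult_reduced_cohomology_group distrib_right
        intro!: class_in_reduced_cohomology_group assms cocycle_scale)
  have "group (reduced_cohomology_group L p)"
    using assms comm_group_reduced_cohomology_group by (auto simp: comm_group_def)
  from hom_int_pow[OF hom _ group_integer_group this, of 1 n] show ?thesis
    by simp
qed

text \<open>Taking classes is additive; this evaluates the multiplicatively written sums in \<open>double_differential\<close>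
  on representatives.\<close>

lemma finprod_reduced_cohomology_group:
  assumes "finite_complex L" "finite A" "\<And>i. i \<in> A \<Longrightarrow> cocycle L p (f i)"
  shows "finprod (reduced_cohomology_group L p) (\<lambda>i. cohomology_class L p (\<lambda>J. c i * f i J)) A
     = cohomology_class L p (\<lambda>J. \<Sum>i\<in>A. c i * f i J)"
proof -
  interpret H: comm_group "reduced_cohomology_group L p"
    by (rule comm_group_reduced_cohomology_group[OF assms(1)])
  show ?thesis
    using assms(2,3)
  proof (induction A)
    case empty
    then show ?case by (simp add: one_reduced_cohomology_group assms(1))
  next
    case (insert i A)
    then show ?case
      by (subst H.finprod_insert)
        (auto simp: Pi_iff mult_reduced_cohomology_group
          intro!: class_in_reduced_cohomology_group assms(1) cocycle_scale)
  qed
qed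

text \<open>A coboundary of \<open>M\<close> restricts to a coboundary of \<open>L\<close>, so enlarging the restricted coset by the coboundaries
  of \<open>L\<close> yields exactly one class.\<close>

lemma cohomology_restrict_class:
  assumes "finite_complex L" "L \<subseteq> M"
  shows "cohomology_restrict L p (cohomology_class M p f) = cohomology_class L p f"
proof -
  have sub: "faces L p \<subseteq> faces M p"
    using assms(2) by (auto simp: faces_def)
  have "cohomology_restrict L p (cohomology_class M p f)
      = cohomology_class L p (\<lambda>_. 0) <#>\<^bsub>cochain_group L p\<^esub> (\<lambda>g. restrict g (faces L p)) ` cohomology_class M p f"
    by (simp add: cohomology_restrict_def coboundaries_eq[OF assms(1)] del: carrier_cochain_group)
  also have "\<dots> = cohomology_class L p f"
  proof (intro equalityI subsetI)
    fix h assume "h \<in> cohomology_class L p (\<lambda>_. 0)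
      <#>\<^bsub>cochain_group L p\<^esub> (\<lambda>g. restrict g (faces L p)) ` cohomology_class M p f"
    then obtain a b where ab: "h = (\<lambda>J\<in>faces L p. a J + b J)"
      "a \<in> cohomology_class L p (\<lambda>_. 0)" "b \<in> cohomology_class M p f"
      unfolding set_mult_def by (auto cong: restrict_cong)
    then obtain u v where
      "\<And>J. J \<in> faces L p \<Longrightarrow> a J = delta u J" "\<And>J. J \<in> faces M p \<Longrightarrow> b J = delta v J + f J"
      by (auto simp: cohomology_class_def)
    with ab(1) show "h \<in> cohomology_class L p f"
      using sub by (auto simp: cohomology_class_def delta_add subset_iff intro!: exI[of _ "\<lambda>J. u J + v J"])
  next
    fix h assume "h \<in> cohomology_class L p f"
    then obtain u where h: "h \<in> extensional (faces L p)" "\<And>J. J \<in> faces L p \<Longrightarrow> h J = delta u J + f J"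
      by (auto simp: cohomology_class_def)
    have "h = restrict (delta u) (faces L p)
        \<otimes>\<^bsub>cochain_group L p\<^esub> restrict (restrict f (faces M p)) (faces L p)"
      using h sub by (auto simp: fun_eq_iff extensional_def)
    moreover have "restrict (delta u) (faces L p) \<in> cohomology_class L p (\<lambda>_. 0)"
      by (auto simp: cohomology_class_def)
    moreover have "restrict f (faces M p) \<in> cohomology_class M p f"
      by (auto simp: cohomology_class_def intro: exI[of _ "\<lambda>_. 0"])
    ultimately show "h \<in> cohomology_class L p (\<lambda>_. 0)
      <#>\<^bsub>cochain_group L p\<^esub> (\<lambda>g. restrict g (faces L p)) ` cohomology_class M p f"
      unfolding set_mult_def by blast
  qed
  finally show ?thesis .
qed

lemma trivial_reduced_cohomology_group_iff:
  assumes "finite_complex L"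
  shows "trivial_group (reduced_cohomology_group L p)
     \<longleftrightarrow> (\<forall>f. cocycle L p f \<longrightarrow> (\<exists>u. \<forall>J\<in>faces L p. f J = delta u J))"
proof -
  have "group (reduced_cohomology_group L p)"
    using assms comm_group_reduced_cohomology_group by (auto simp: comm_group_def)
  then have "trivial_group (reduced_cohomology_group L p)
      \<longleftrightarrow> (\<forall>f. cocycle L p f \<longrightarrow> cohomology_class L p f = cohomology_class L p (\<lambda>_. 0))"
    by (auto simp: group.trivial_group_subset carrier_reduced_cohomology_group one_reduced_cohomology_group assms)
  then show ?thesis
    by (simp add: cohomology_class_eq_iff)
qed

section \<open>Homology of a short sequence of groups\<close>

text \<open>Exactness at the middle term, extracted from the quotient: the coset of a cycle is the trivial
  coset, and it contains the cycle because the image contains the unit.\<close>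

lemma homology_at_trivialD:
  assumes "trivial_group (homology_at A f B g C)" "group B"
    and "x \<in> carrier B" "g x = \<one>\<^bsub>C\<^esub>" "\<one>\<^bsub>B\<^esub> \<in> f ` carrier A"
  shows "x \<in> f ` carrier A"
proof -
  interpret B: group B by fact
  have "x \<in> carrier (subgroup_generated B (kernel B C g))"
    using B.subgroup_generated_subset_carrier_subset[of "kernel B C g"] assms(3,4) by (auto simp: kernel_def)
  then have "f ` carrier A #>\<^bsub>subgroup_generated B (kernel B C g)\<^esub> x \<in> carrier (homology_at A f B g C)"
    by (simp add: homology_at_def carrier_FactGroup del: mult_subgroup_generated)
  then have "f ` carrier A #>\<^bsub>subgroup_generated B (kernel B C g)\<^esub> x = f ` carrier A"
    using assms(1) by (simp add: trivial_group_def homology_at_def)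
  moreover have "\<one>\<^bsub>B\<^esub> \<otimes>\<^bsub>B\<^esub> x \<in> f ` carrier A #>\<^bsub>subgroup_generated B (kernel B C g)\<^esub> x"
    using assms(5) by (auto simp: r_coset_def)
  ultimately show ?thesis
    using assms(3) by simp
qed

lemma homology_at_trivial_middle:
  assumes "trivial_group B" "f ` carrier A = {\<one>\<^bsub>B\<^esub>}"
  shows "trivial_group (homology_at A f B g C)"
proof -
  interpret B: group B using assms(1) by (simp add: trivial_group_def)
  let ?Z = "subgroup_generated B (kernel B C g)"
  interpret Z: group ?Z by simp
  have "group (?Z Mod {\<one>\<^bsub>?Z\<^esub>})"
    using normal.factorgroup_is_group Z.one_is_normal by blast
  moreover have "carrier ?Z = {\<one>\<^bsub>B\<^esub>}"
  proof (rule equalityI)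
    show "carrier ?Z \<subseteq> {\<one>\<^bsub>B\<^esub>}"
      using B.carrier_subgroup_generated_subset[of "kernel B C g"] assms(1) by (simp add: trivial_group_def)
    show "{\<one>\<^bsub>B\<^esub>} \<subseteq> carrier ?Z"
      using Z.one_closed by (simp only: one_subgroup_generated) blast
  qed
  ultimately show ?thesis
    unfolding homology_at_def assms(2) trivial_group_def
    by (simp add: carrier_FactGroup r_coset_def)
qed

lemma homology_at_iso_middle:
  assumes "group B" "f ` carrier A = {\<one>\<^bsub>B\<^esub>}" "\<And>x. x \<in> carrier B \<Longrightarrow> g x = \<one>\<^bsub>C\<^esub>"
  shows "homology_at A f B g C \<cong> B"
proof -
  interpret B: group B by fact
  have "kernel B C g = carrier B"
    using assms(3) by (auto simp: kernel_def)
  then have "homology_at A f B g C = B Mod {\<one>\<^bsub>B\<^esub>}"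
    by (simp add: homology_at_def assms(2) B.subgroup_generated_group_carrier)
  then show ?thesis
    using is_isoI[OF B.trivial_factor_iso] by simp
qed

section \<open>The double complex of full subcomplexes\<close>

lemma finite_complex_full_subcomplex:
  assumes "simplicial_complex m K"
  shows "finite_complex (full_subcomplex K I)"
  unfolding finite_complex_def
proof
  fix J assume J: "J \<in> full_subcomplex K I"
  then have "J \<subseteq> {1..m}" "Pow J \<subseteq> K" "J \<subseteq> I"
    using assms by (auto simp: simplicial_complex_def full_subcomplex_def)
  then show "finite J \<and> Pow J \<subseteq> full_subcomplex K I"
    using finite_subset[of J "{1..m}"] by (auto simp: full_subcomplex_def)
qed

lemma full_subcomplex_mono: "I \<subseteq> I' \<Longrightarrow> full_subcomplex K I \<subseteq> full_subcomplex K I'"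
  by (auto simp: full_subcomplex_def)

definition vertex_subsets :: "nat \<Rightarrow> int \<Rightarrow> nat set set" where
  "vertex_subsets m l = {I. I \<subseteq> {1..m} \<and> int (card I) = l}"

lemma finite_vertex_subsets [simp]: "finite (vertex_subsets m l)"
  by (rule finite_subset[of _ "Pow {1..m}"]) (auto simp: vertex_subsets_def)

lemma insert_vertex_subsets:
  assumes "I \<in> vertex_subsets m (l - 1)" "i \<in> {1..m} - I"
  shows "insert i I \<in> vertex_subsets m l"
proof -
  have "finite I"
    using assms(1) finite_subset[of I "{1..m}"] by (auto simp: vertex_subsets_def)
  then show ?thesis
    using assms by (auto simp: vertex_subsets_def)
qed

text \<open>The differential \<open>d'\<close> on cochain level, without the global sign \<open>(-1) ^ (p + 1)\<close>.\<close>

definition vertex_deletion ::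
  "nat \<Rightarrow> (nat set \<Rightarrow> nat set \<Rightarrow> int) \<Rightarrow> nat set \<Rightarrow> nat set \<Rightarrow> int" where
  "vertex_deletion m z I J = (\<Sum>i\<in>{1..m} - I. vertex_sign i (insert i I) * z (insert i I) J)"

lemma vertex_deletion_add:
  "vertex_deletion m (\<lambda>I J. y I J + z I J) I J = vertex_deletion m y I J + vertex_deletion m z I J"
  by (simp add: vertex_deletion_def distrib_left sum.distrib)

lemma vertex_deletion_scale:
  "vertex_deletion m (\<lambda>I J. c * z I J) I J = c * vertex_deletion m z I J"
  by (simp add: vertex_deletion_def sum_distrib_left mult.left_commute)

text \<open>The maps \<open>d\<close> and \<open>d'\<close> commute because \<open>d'\<close> only restricts cochains to subcomplexes.\<close>

lemma vertex_deletion_delta: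
  "vertex_deletion m (\<lambda>I. delta (z I)) I J = delta (vertex_deletion m z I) J"
  using delta_sum[of "\<lambda>i. vertex_sign i (insert i I)" "\<lambda>i. z (insert i I)" "{1..m} - I" J]
  by (simp add: vertex_deletion_def[abs_def])

lemma vertex_deletion_twice:
  assumes "I \<subseteq> {1..m}"
  shows "vertex_deletion m (vertex_deletion m z) I J = 0"
proof -
  let ?A = "{1..m} - I"
  have "vertex_deletion m (vertex_deletion m z) I J
      = (\<Sum>i\<in>?A. \<Sum>j\<in>?A - {i}. vertex_sign i (insert i I)
            * (vertex_sign j (insert j (insert i I)) * z (insert j (insert i I)) J))"
    unfolding vertex_deletion_def sum_distrib_left by (intro sum.cong refl) auto
  also have "\<dots> = 0"
  proof (rule sum_antisymmetric_offdiagonal)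
    fix i j assume ij: "i \<in> ?A" "j \<in> ?A" "i \<noteq> j"
    let ?T = "insert i (insert j I)"
    have T: "?T - {j} = insert i I" "?T - {i} = insert j I" "insert j (insert i I) = ?T"
      using ij by auto
    have "finite ?T"
      using assms finite_subset by auto
    from vertex_sign_swap[OF this, of i j] ij(3)
    have "vertex_sign i (insert i I) * vertex_sign j ?T = - (vertex_sign j (insert j I) * vertex_sign i ?T)"
      unfolding T by simp
    then show "vertex_sign i (insert i I) * (vertex_sign j (insert j (insert i I)) * z (insert j (insert i I)) J)
        = - (vertex_sign j (insert j I) * (vertex_sign i ?T * z ?T J))"
      unfolding T by (simp flip: mult.assoc)
  qed simp
  finally show ?thesis .
qed

lemma bigraded_cohomology_eq:
  "bigraded_cohomology m K k l
     = sum_group (vertex_subsets m l) (\<lambda>I. reduced_cohomology_group (full_subcomplex K I) (l - k - 1))"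
  by (simp only: bigraded_cohomology_def vertex_subsets_def)

lemma carrier_bigraded_cohomology:
  assumes "simplicial_complex m K"
  shows "carrier (bigraded_cohomology m K k l)
     = (\<Pi>\<^sub>E I\<in>vertex_subsets m l. carrier (reduced_cohomology_group (full_subcomplex K I) (l - k - 1)))"
proof -
  have "group (reduced_cohomology_group (full_subcomplex K I) p)" for I p
    using comm_group_reduced_cohomology_group finite_complex_full_subcomplex[OF assms]
    by (auto simp: comm_group_def)
  then show ?thesis
    by (simp add: bigraded_cohomology_eq carrier_sum_group)
qed

lemma group_bigraded_cohomology:
  assumes "simplicial_complex m K"
  shows "group (bigraded_cohomology m K k l)"
  unfolding bigraded_cohomology_def
  using comm_group_reduced_cohomology_group finite_complex_full_subcomplex[OF assms]
  by (intro sum_group) (auto simp: comm_group_def)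

definition class_family ::
  "nat \<Rightarrow> nat set set \<Rightarrow> int \<Rightarrow> int \<Rightarrow> (nat set \<Rightarrow> nat set \<Rightarrow> int) \<Rightarrow> nat set \<Rightarrow> (nat set \<Rightarrow> int) set" where
  "class_family m K k l z =
     (\<lambda>I\<in>vertex_subsets m l. cohomology_class (full_subcomplex K I) (l - k - 1) (z I))"

definition cocycle_family ::
  "nat \<Rightarrow> nat set set \<Rightarrow> int \<Rightarrow> int \<Rightarrow> (nat set \<Rightarrow> nat set \<Rightarrow> int) \<Rightarrow> bool" where
  "cocycle_family m K k l z \<longleftrightarrow>
     (\<forall>I\<in>vertex_subsets m l. cocycle (full_subcomplex K I) (l - k - 1) (z I))"

lemma carrier_bigraded_cohomology_classes:
  assumes "simplicial_complex m K"
  shows "carrier (bigraded_cohomology m K k l) = class_family m K k l ` {z. cocycle_family m K k l z}"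
proof (intro equalityI subsetI)
  fix x assume "x \<in> carrier (bigraded_cohomology m K k l)"
  then have x: "x \<in> extensional (vertex_subsets m l)"
    "\<And>I. I \<in> vertex_subsets m l \<Longrightarrow> \<exists>f. cocycle (full_subcomplex K I) (l - k - 1) f
        \<and> x I = cohomology_class (full_subcomplex K I) (l - k - 1) f"
    by (auto simp: carrier_bigraded_cohomology[OF assms] PiE_iff
        carrier_reduced_cohomology_group[OF finite_complex_full_subcomplex[OF assms]])
  from bchoice[of "vertex_subsets m l"] x(2) obtain z where z: "\<And>I. I \<in> vertex_subsets m l \<Longrightarrow>
      cocycle (full_subcomplex K I) (l - k - 1) (z I)
        \<and> x I = cohomology_class (full_subcomplex K I) (l - k - 1) (z I)"
    by metis
  have "x = class_family m K k l z"
    using x(1) z by (auto simp: class_family_def fun_eq_iff extensional_def)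
  then show "x \<in> class_family m K k l ` {z. cocycle_family m K k l z}"
    using z by (auto simp: cocycle_family_def)
qed (auto simp: carrier_bigraded_cohomology[OF assms] class_family_def cocycle_family_def
      intro!: class_in_reduced_cohomology_group finite_complex_full_subcomplex[OF assms])

lemma one_bigraded_cohomology:
  assumes "simplicial_complex m K"
  shows "\<one>\<^bsub>bigraded_cohomology m K k l\<^esub> = class_family m K k l (\<lambda>_ _. 0)"
  by (simp add: bigraded_cohomology_eq class_family_def
      one_reduced_cohomology_group finite_complex_full_subcomplex[OF assms])

lemma cocycle_family_zero [simp]: "cocycle_family m K k l (\<lambda>_ _. 0)"
  by (simp add: cocycle_family_def)

lemma class_family_eq_iff:
  "class_family m K k l y = class_family m K k l z \<longleftrightarrow>
     (\<exists>u. \<forall>I\<in>vertex_subsets m l. \<forall>J\<in>faces (full_subcomplex K I) (l - k - 1).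
        y I J = z I J + delta (u I) J)"
proof -
  have "class_family m K k l y = class_family m K k l z \<longleftrightarrow>
      (\<forall>I\<in>vertex_subsets m l. cohomology_class (full_subcomplex K I) (l - k - 1) (y I)
         = cohomology_class (full_subcomplex K I) (l - k - 1) (z I))"
    by (auto simp: class_family_def fun_eq_iff restrict_def)
  then show ?thesis
    unfolding cohomology_class_eq_iff by (simp only: bchoice_iff)
qed

lemma cocycle_full_subcomplex_mono:
  "cocycle (full_subcomplex K I') p f \<Longrightarrow> I \<subseteq> I' \<Longrightarrow> cocycle (full_subcomplex K I) p f"
  by (auto simp: cocycle_def faces_def full_subcomplex_def)

text \<open>On representatives the differential is vertex deletion, up to the sign \<open>(-1) ^ (l - k)\<close>; this turns
  statements about cosets into equations between functions.\<close>

lemma double_differential_class_family: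
  assumes "simplicial_complex m K" "cocycle_family m K k l z"
  shows "double_differential m K k l (class_family m K k l z)
     = class_family m K (k - 1) (l - 1) (vertex_deletion m (\<lambda>I J. (if even (l - k) then 1 else - 1) * z I J))"
proof -
  note fin = finite_complex_full_subcomplex[OF assms(1)]
  define s :: int where "s = (if even (l - k) then 1 else - 1)"
  let ?p = "l - k - 1"
  have "finprod (reduced_cohomology_group (full_subcomplex K I) ?p)
          (\<lambda>i. cohomology_restrict (full_subcomplex K I) ?p (class_family m K k l z (insert i I))
             [^]\<^bsub>reduced_cohomology_group (full_subcomplex K I) ?p\<^esub> (s * vertex_sign i (insert i I)))
          ({1..m} - I)
      = cohomology_class (full_subcomplex K I) ?p (vertex_deletion m (\<lambda>I J. s * z I J) I)"
    if I: "I \<in> vertex_subsets m (l - 1)" for I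
  proof -
    let ?L = "full_subcomplex K I"
    interpret H: comm_group "reduced_cohomology_group ?L ?p"
      by (rule comm_group_reduced_cohomology_group[OF fin])
    have coc: "cocycle ?L ?p (z (insert i I))" if "i \<in> {1..m} - I" for i
      using assms(2) insert_vertex_subsets[OF I that]
      by (auto simp: cocycle_family_def intro: cocycle_full_subcomplex_mono)
    have eq: "cohomology_restrict ?L ?p (class_family m K k l z (insert i I))
             [^]\<^bsub>reduced_cohomology_group ?L ?p\<^esub> (s * vertex_sign i (insert i I))
        = cohomology_class ?L ?p (\<lambda>J. (s * vertex_sign i (insert i I)) * z (insert i I) J)"
      if "i \<in> {1..m} - I" for i
    proof -
      have "cohomology_restrict ?L ?p (class_family m K k l z (insert i I))
          = cohomology_class ?L ?p (z (insert i I))"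
        using insert_vertex_subsets[OF I that] full_subcomplex_mono[of I "insert i I" K]
        by (simp add: class_family_def cohomology_restrict_class fin subset_insertI)
      then show ?thesis
        using int_pow_reduced_cohomology_group[OF fin coc[OF that]] by simp
    qed
    have "finprod (reduced_cohomology_group ?L ?p)
          (\<lambda>i. cohomology_restrict ?L ?p (class_family m K k l z (insert i I))
             [^]\<^bsub>reduced_cohomology_group ?L ?p\<^esub> (s * vertex_sign i (insert i I)))
          ({1..m} - I)
        = finprod (reduced_cohomology_group ?L ?p)
          (\<lambda>i. cohomology_class ?L ?p (\<lambda>J. (s * vertex_sign i (insert i I)) * z (insert i I) J))
          ({1..m} - I)"
      by (rule H.finprod_cong')
        (use eq coc in \<open>auto intro!: class_in_reduced_cohomology_group fin cocycle_scale\<close>)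
    also have "\<dots> = cohomology_class ?L ?p
        (\<lambda>J. \<Sum>i\<in>{1..m} - I. (s * vertex_sign i (insert i I)) * z (insert i I) J)"
      by (rule finprod_reduced_cohomology_group) (use coc fin in auto)
    also have "(\<lambda>J. \<Sum>i\<in>{1..m} - I. (s * vertex_sign i (insert i I)) * z (insert i I) J)
        = vertex_deletion m (\<lambda>I J. s * z I J) I"
      by (simp add: vertex_deletion_def fun_eq_iff mult.assoc mult.left_commute)
    finally show ?thesis .
  qed
  moreover have "(if even (l - k - 1 + 1) then 1 else - 1) = s" "l - 1 - (k - 1) - 1 = l - k - 1"
    by (simp_all add: s_def)
  ultimately show ?thesis
    unfolding double_differential_def class_family_def[of m K "k - 1"] Let_def
      vertex_subsets_def[symmetric] s_def[symmetric] by (simp cong: restrict_cong)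
qed

lemma cocycle_family_vertex_deletion:
  assumes "cocycle_family m K k l z"
  shows "cocycle_family m K (k - 1) (l - 1) (vertex_deletion m z)"
proof -
  have "cocycle (full_subcomplex K I) (l - k - 1) (\<lambda>J. vertex_deletion m z I J)"
    if I: "I \<in> vertex_subsets m (l - 1)" for I
    unfolding vertex_deletion_def
    using assms insert_vertex_subsets[OF I]
    by (intro cocycle_sum) (auto simp: cocycle_family_def intro: cocycle_full_subcomplex_mono)
  then show ?thesis
    by (simp add: cocycle_family_def)
qed

lemma double_differential_closed:
  assumes "simplicial_complex m K" "x \<in> carrier (bigraded_cohomology m K k l)"
  shows "double_differential m K k l x \<in> carrier (bigraded_cohomology m K (k - 1) (l - 1))"
proof -
  obtain z where z: "x = class_family m K k l z" "cocycle_family m K k l z"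
    using assms by (auto simp: carrier_bigraded_cohomology_classes)
  have "cocycle_family m K k l (\<lambda>I J. (if even (l - k) then 1 else - 1) * z I J)"
    using z(2) cocycle_scale[of _ _ _ "if even (l - k) then 1 else - 1"] by (simp add: cocycle_family_def)
  from cocycle_family_vertex_deletion[OF this] show ?thesis
    unfolding z(1) double_differential_class_family[OF assms(1) z(2)]
      carrier_bigraded_cohomology_classes[OF assms(1)] by blast
qed

lemma double_differential_one:
  assumes "simplicial_complex m K"
  shows "double_differential m K k l \<one>\<^bsub>bigraded_cohomology m K k l\<^esub>
     = \<one>\<^bsub>bigraded_cohomology m K (k - 1) (l - 1)\<^esub>"
  using double_differential_class_family[OF assms, of k l "\<lambda>_ _. 0"]
  by (simp add: one_bigraded_cohomology assms vertex_deletion_def[abs_def])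

text \<open>The zig-zag form of vanishing double cohomology: a family of cocycles that \<open>d'\<close> maps to coboundaries is
  \<open>d' w + d u\<close>.\<close>

lemma double_cohomology_trivialD:
  assumes sc: "simplicial_complex m K" and triv: "trivial_group (double_cohomology m K k l)"
    and z: "cocycle_family m K k l z"
    and bd: "\<And>I J. I \<in> vertex_subsets m (l - 1) \<Longrightarrow> J \<in> faces (full_subcomplex K I) (l - k - 1) \<Longrightarrow>
           vertex_deletion m z I J = delta (v I) J"
  obtains w u where
    "\<And>I J. I \<in> vertex_subsets m l \<Longrightarrow> J \<in> faces (full_subcomplex K I) (l - k - 1) \<Longrightarrow>
       z I J = vertex_deletion m w I J + delta (u I) J"
proof -
  let ?A = "bigraded_cohomology m K (k + 1) (l + 1)"
  let ?B = "bigraded_cohomology m K k l"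
  let ?d = "double_differential m K (k + 1) (l + 1)"
  have grp: "group ?A" "group ?B"
    by (simp_all add: group_bigraded_cohomology sc)
  have x: "class_family m K k l z \<in> carrier ?B"
    using z by (auto simp: carrier_bigraded_cohomology_classes sc)
  have "\<exists>u. \<forall>I\<in>vertex_subsets m (l - 1). \<forall>J\<in>faces (full_subcomplex K I) (l - k - 1).
      vertex_deletion m (\<lambda>I J. (if even (l - k) then 1 else - 1) * z I J) I J = 0 + delta (u I) J"
    by (rule exI[of _ "\<lambda>I J. (if even (l - k) then 1 else - 1) * v I J"])
      (intro ballI, simp only: vertex_deletion_scale delta_scale, simp add: bd)
  then have kern: "double_differential m K k l (class_family m K k l z)
      = \<one>\<^bsub>bigraded_cohomology m K (k - 1) (l - 1)\<^esub>"
    unfolding double_differential_class_family[OF sc z] one_bigraded_cohomology[OF sc]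
      class_family_eq_iff by simp
  have "\<one>\<^bsub>?B\<^esub> = ?d \<one>\<^bsub>?A\<^esub>"
    using double_differential_one[OF sc, of "k + 1" "l + 1"] by simp
  then have "\<one>\<^bsub>?B\<^esub> \<in> ?d ` carrier ?A"
    using grp(1) group.is_monoid monoid.one_closed by blast
  from homology_at_trivialD[of ?A ?d ?B "double_differential m K k l", OF
      triv[unfolded double_cohomology_def] grp(2) x kern this]
  have "class_family m K k l z \<in> ?d ` carrier ?A" .
  then obtain w where w: "cocycle_family m K (k + 1) (l + 1) w"
    "class_family m K k l z = ?d (class_family m K (k + 1) (l + 1) w)"
    by (auto simp: carrier_bigraded_cohomology_classes sc)
  show thesis
    using w(2) that unfolding double_differential_class_family[OF sc w(1)]
    by (auto simp: class_family_eq_iff)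
qed

section \<open>Trivial double cohomology forces a simplex\<close>

lemma vertex_sign_last: "vertex_sign (Suc n) {1..Suc n} = (-1) ^ n"
proof -
  have "{r \<in> {1..Suc n}. r < Suc n} = {1..n}" by auto
  then show ?thesis by (simp add: vertex_sign_def)
qed

text \<open>The cochains \<open>y\<^sub>n\<close> of the introduction: the face \<open>{1..n-1}\<close> of the full subcomplex on \<open>{1..n}\<close>.\<close>

definition staircase :: "nat \<Rightarrow> nat set \<Rightarrow> nat set \<Rightarrow> int" where
  "staircase n I J = (if I = {1..n} \<and> J = {1..n - 1} then 1 else 0)"

text \<open>In the dimension of the cocycle condition for \<open>y\<^sub>n\<close> the only possible face of \<open>K\<^sub>I\<close> is \<open>I\<close>
  itself, so all identities for the staircase need to be checked at a single face.\<close>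

lemma faces_full_subcomplex_top:
  assumes "finite I" "J \<in> faces (full_subcomplex K I) (int (card I) - 1)"
  shows "J = I" "I \<in> K"
proof -
  have J: "J \<in> K" "J \<subseteq> I" "card J = card I"
    using assms(2) by (auto simp: faces_def full_subcomplex_def)
  then show "J = I"
    using card_subset_eq assms(1) by blast
  with J(1) show "I \<in> K" by simp
qed

lemma delta_staircase:
  assumes "card I = Suc n"
  shows "delta (staircase (Suc n) I) I = (if I = {1..Suc n} then (-1) ^ n else 0)"
proof (cases "I = {1..Suc n}")
  case True
  have "{1..Suc n} - {j} = {1..n} \<longleftrightarrow> j = Suc n" if "j \<in> {1..Suc n}" for j
  proof
    assume eq: "{1..Suc n} - {j} = {1..n}"
    have "Suc n \<in> {1..Suc n}" "Suc n \<notin> {1..n}" by auto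
    then show "j = Suc n" using eq by blast
  qed auto
  then have "delta (staircase (Suc n) I) I
      = (\<Sum>j\<in>{1..Suc n}. if j = Suc n then vertex_sign j {1..Suc n} else 0)"
    unfolding delta_def staircase_def True by (intro sum.cong refl) simp
  also have "\<dots> = vertex_sign (Suc n) {1..Suc n}"
    by (subst sum.delta) auto
  finally show ?thesis
    unfolding vertex_sign_last using True by simp
qed (simp add: delta_def staircase_def)

text \<open>Compared with \<open>delta_staircase\<close>, this is \<open>d' y\<^sub>n\<^sub>+\<^sub>1 = - d y\<^sub>n\<close>; for \<open>n = 0\<close> it says that \<open>d' y\<^sub>1\<close> is
  the generator on the empty vertex set.\<close>

lemma vertex_deletion_staircase:
  assumes "I \<subseteq> {1..m}" "card I = n" "Suc n \<le> m"
  shows "vertex_deletion m (staircase (Suc n)) I I = (if I = {1..n} then (-1) ^ n else 0)"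
proof (cases "I = {1..n}")
  case True
  have "insert i {1..n} = {1..Suc n} \<longleftrightarrow> i = Suc n" if "i \<in> {1..m} - {1..n}" for i
  proof
    assume "insert i {1..n} = {1..Suc n}"
    then have "Suc n \<in> insert i {1..n}" by auto
    then show "i = Suc n" by auto
  qed auto
  then have "vertex_deletion m (staircase (Suc n)) I I
      = (\<Sum>i\<in>{1..m} - {1..n}. if i = Suc n then vertex_sign i (insert i {1..n}) else 0)"
    unfolding vertex_deletion_def staircase_def True by (intro sum.cong refl) auto
  also have "\<dots> = vertex_sign (Suc n) {1..Suc n}"
    using assms(3) by (subst sum.delta) (auto simp: atLeastAtMostSuc_conv)
  finally show ?thesis
    unfolding vertex_sign_last using True by simp
qed (simp add: vertex_deletion_def staircase_def)

text \<open>Adding \<open>d' v\<close> to \<open>y\<^sub>n\<close> turns it into a family of cocycles and leaves \<open>d' y\<^sub>n\<close> unchanged.\<close>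

definition correctable :: "nat \<Rightarrow> nat set set \<Rightarrow> nat \<Rightarrow> bool" where
  "correctable m K n \<longleftrightarrow> (\<exists>v. cocycle_family m K 1 (int n)
     (\<lambda>I J. staircase n I J + vertex_deletion m v I J))"

lemma correctable_start:
  assumes "{1..n} \<notin> K" "n \<ge> 1"
  shows "correctable m K n"
proof -
  obtain n' where n': "n = Suc n'" using assms(2) by (cases n) auto
  have "cocycle_family m K 1 (int n) (\<lambda>I J. staircase n I J + vertex_deletion m (\<lambda>_ _. 0) I J)"
    unfolding cocycle_family_def cocycle_def
  proof (intro ballI)
    fix I J assume I: "I \<in> vertex_subsets m (int n)" and J: "J \<in> faces (full_subcomplex K I) (int n - 1 - 1 + 1)"
    have "finite I" "card I = n"
      using I finite_subset[of I "{1..m}"] by (auto simp: vertex_subsets_def)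
    with J faces_full_subcomplex_top[of I J K] have "J = I" "I \<in> K"
      by auto
    then show "delta (\<lambda>J. staircase n I J + vertex_deletion m (\<lambda>_ _. 0) I J) J = 0"
      using delta_staircase[of I n'] \<open>card I = n\<close> assms(1) by (auto simp: vertex_deletion_def n')
  qed
  then show ?thesis
    unfolding correctable_def by blast
qed

text \<open>One step of the zig-zag.  From \<open>z = y\<^sub>n\<^sub>+\<^sub>1 + d' v\<close> one gets \<open>d' z = - d y\<^sub>n\<close>, so
  \<open>z = d' w + d u\<close>, and applying \<open>d'\<close> gives \<open>- d y\<^sub>n = d (d' u)\<close>.\<close>

lemma correctable_step:
  assumes sc: "simplicial_complex m K" and triv: "\<And>l. trivial_group (double_cohomology m K 1 l)"
    and n: "1 \<le> n" "Suc n \<le> m" and corr: "correctable m K (Suc n)"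
  shows "correctable m K n"
proof -
  note fin = finite_complex_full_subcomplex[OF sc]
  obtain n' where n': "n = Suc n'" using n(1) by (cases n) auto
  obtain v where v: "cocycle_family m K 1 (int (Suc n)) (\<lambda>I J. staircase (Suc n) I J + vertex_deletion m v I J)"
    using corr by (auto simp: correctable_def)
  let ?z = "\<lambda>I J. staircase (Suc n) I J + vertex_deletion m v I J"
  have del: "vertex_deletion m ?z I J = - delta (staircase n I) J"
    if I: "I \<in> vertex_subsets m (int n)" and J: "J \<in> faces (full_subcomplex K I) (int n - 1)" for I J
  proof -
    have I': "I \<subseteq> {1..m}" "finite I" "card I = n"
      using I finite_subset[of I "{1..m}"] by (auto simp: vertex_subsets_def)
    have J': "J = I"
      using faces_full_subcomplex_top[of I J K] J I' by simp
    show ?thesis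
      unfolding vertex_deletion_add vertex_deletion_twice[OF I'(1)] J'
        vertex_deletion_staircase[OF I'(1,3) n(2)] using delta_staircase[of I n'] I'(3) n' by simp
  qed
  obtain w u where wu: "\<And>I J. I \<in> vertex_subsets m (int (Suc n)) \<Longrightarrow>
      J \<in> faces (full_subcomplex K I) (int (Suc n) - 1 - 1) \<Longrightarrow>
      ?z I J = vertex_deletion m w I J + delta (u I) J"
  proof (rule double_cohomology_trivialD[OF sc triv v])
    fix I J assume "I \<in> vertex_subsets m (int (Suc n) - 1)"
      "J \<in> faces (full_subcomplex K I) (int (Suc n) - 1 - 1)"
    then show "vertex_deletion m ?z I J = delta (\<lambda>J. - 1 * staircase n I J) J"
      unfolding delta_scale using del[of I J] by simp
  qed (use that in auto)
  have "delta (\<lambda>J. staircase n I J + vertex_deletion m u I J) J = 0"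
    if I: "I \<in> vertex_subsets m (int n)" and J: "J \<in> faces (full_subcomplex K I) (int n - 1)" for I J
  proof -
    have "?z (insert i I) J = vertex_deletion m w (insert i I) J + delta (u (insert i I)) J"
      if i: "i \<in> {1..m} - I" for i
    proof (rule wu)
      show "insert i I \<in> vertex_subsets m (int (Suc n))"
        using insert_vertex_subsets[of I m "int (Suc n)" i] I i by simp
      show "J \<in> faces (full_subcomplex K (insert i I)) (int (Suc n) - 1 - 1)"
        using J full_subcomplex_mono[of I "insert i I" K] by (auto simp: faces_def)
    qed
    then have "vertex_deletion m ?z I J
        = vertex_deletion m (\<lambda>I J. vertex_deletion m w I J + delta (u I) J) I J"
      unfolding vertex_deletion_def[of m _ I] by (intro sum.cong refl) simp
    also have "\<dots> = delta (vertex_deletion m u I) J"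
      unfolding vertex_deletion_add
      using I vertex_deletion_twice[of I m w J] vertex_deletion_delta[of m u I J]
      by (simp add: vertex_subsets_def)
    finally show ?thesis
      using del[OF I J] delta_add[of "staircase n I" "vertex_deletion m u I" J] by simp
  qed
  then have "cocycle_family m K 1 (int n) (\<lambda>I J. staircase n I J + vertex_deletion m u I J)"
    by (simp add: cocycle_family_def cocycle_def)
  then show ?thesis
    unfolding correctable_def by blast
qed

text \<open>In dimension \<open>-1\<close> the coboundary of a point is injective, so a family of cocycles is zero there and
  cannot be mapped by \<open>d'\<close> to the generator on the empty vertex set.\<close>

lemma not_correctable_one:
  assumes sc: "simplicial_complex m K" and m: "m \<ge> 1"
  shows "\<not> correctable m K 1"
proof
  assume "correctable m K 1"
  then obtain v where v: "cocycle_family m K 1 1 (\<lambda>I J. staircase 1 I J + vertex_deletion m v I J)"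
    by (auto simp: correctable_def)
  let ?z = "\<lambda>I J. staircase 1 I J + vertex_deletion m v I J"
  have z0: "?z {i} {} = 0" if i: "i \<in> {1..m}" for i
  proof -
    have "{i} \<in> vertex_subsets m 1" "{i} \<in> faces (full_subcomplex K {i}) 0"
      using i sc by (auto simp: vertex_subsets_def faces_def full_subcomplex_def simplicial_complex_def)
    then have "delta (?z {i}) {i} = 0"
      using v by (auto simp: cocycle_family_def cocycle_def)
    moreover have "vertex_sign i {i} = 1"
    proof -
      have no: "{r \<in> {i}. r < i} = {}" by auto
      show ?thesis unfolding vertex_sign_def no by simp
    qed
    ultimately show ?thesis
      by (simp add: delta_def)
  qed
  have "vertex_deletion m ?z {} {} = 0"
    unfolding vertex_deletion_def[of m _ "{}"] using z0 by simp
  then show False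
    using vertex_deletion_staircase[of "{}" m 0] vertex_deletion_twice[of "{}" m v "{}"] m
    by (simp add: vertex_deletion_add)
qed

lemma full_simplex_if_double_cohomology_trivial:
  assumes sc: "simplicial_complex m K" and m: "m \<ge> 1"
    and triv: "\<And>l. trivial_group (double_cohomology m K 1 l)"
  shows "K = Pow {1..m}"
proof (rule ccontr)
  assume "K \<noteq> Pow {1..m}"
  then have "{1..m} \<notin> K"
    using sc by (auto simp: simplicial_complex_def)
  then have "correctable m K m"
    using correctable_start m by blast
  have "correctable m K 1"
    using m
  proof (induction rule: inc_induct)
    case base
    show ?case by fact
  next
    case (step n)
    then show ?case
      using correctable_step[OF sc triv, of n] by simp
  qed
  then show False
    using not_correctable_one[OF sc m] by simp
qed

section \<open>Double cohomology of a complex with acyclic full subcomplexes\<close>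

lemma trivial_reduced_cohomology_no_faces:
  assumes "finite_complex L" "faces L p = {}"
  shows "trivial_group (reduced_cohomology_group L p)"
  using assms by (simp add: trivial_reduced_cohomology_group_iff)

lemma faces_empty_subcomplex:
  assumes "simplicial_complex m K"
  shows "faces (full_subcomplex K {}) p = (if p = - 1 then {{}} else {})"
  using assms by (auto simp: faces_def full_subcomplex_def simplicial_complex_def)

lemma trivial_bigraded_cohomology:
  assumes "simplicial_complex m K"
    and "\<And>I. I \<in> vertex_subsets m l \<Longrightarrow> trivial_group (reduced_cohomology_group (full_subcomplex K I) (l - k - 1))"
  shows "trivial_group (bigraded_cohomology m K k l)"
proof -
  have "carrier (bigraded_cohomology m K k l)
      = (\<Pi>\<^sub>E I\<in>vertex_subsets m l. {\<one>\<^bsub>reduced_cohomology_group (full_subcomplex K I) (l - k - 1)\<^esub>})"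
    unfolding carrier_bigraded_cohomology[OF assms(1)]
    by (rule PiE_cong) (use assms(2) in \<open>auto simp: trivial_group_def\<close>)
  also have "\<dots> = {\<one>\<^bsub>bigraded_cohomology m K k l\<^esub>}"
    by (auto simp: bigraded_cohomology_eq PiE_iff extensional_def fun_eq_iff)
  finally show ?thesis
    by (simp add: trivial_group_def group_bigraded_cohomology assms(1))
qed

lemma bigraded_cohomology_zero_iso:
  assumes sc: "simplicial_complex m K"
  shows "bigraded_cohomology m K 0 0 \<cong> integer_group"
proof -
  let ?B = "bigraded_cohomology m K 0 0"
  define h where "h n = class_family m K 0 0 (\<lambda>_ _. n)" for n
  have V: "vertex_subsets m 0 = {{}}"
    using finite_subset[of _ "{1..m}"] by (auto simp: vertex_subsets_def)
  have coc: "cocycle_family m K 0 0 z" for z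
    by (simp add: cocycle_family_def V cocycle_def faces_empty_subcomplex[OF sc])
  have eq: "class_family m K 0 0 y = class_family m K 0 0 z \<longleftrightarrow> y {} {} = z {} {}" for y z
    unfolding class_family_eq_iff V by (simp add: faces_empty_subcomplex[OF sc] delta_def)
  have "h \<in> iso integer_group ?B"
  proof (rule isoI)
    show "h \<in> hom integer_group ?B"
    proof (rule homI)
      fix a b :: int
      show "h a \<in> carrier ?B"
        unfolding carrier_bigraded_cohomology_classes[OF sc] h_def using coc by blast
      show "h (a \<otimes>\<^bsub>integer_group\<^esub> b) = h a \<otimes>\<^bsub>?B\<^esub> h b"
        by (simp add: h_def class_family_def bigraded_cohomology_eq mult_reduced_cohomology_group
            cong: restrict_cong)
    qed
    show "bij_betw h (carrier integer_group) (carrier ?B)"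
    proof (rule bij_betw_imageI)
      show "inj_on h (carrier integer_group)"
        by (auto simp: inj_on_def h_def eq)
      have "class_family m K 0 0 z = h (z {} {})" for z
        unfolding h_def eq ..
      moreover have "h n \<in> class_family m K 0 0 ` {z. cocycle_family m K 0 0 z}" for n
        unfolding h_def using coc by blast
      ultimately show "h ` carrier integer_group = carrier ?B"
        unfolding carrier_bigraded_cohomology_classes[OF sc] by auto
    qed
  qed
  then show ?thesis
    using group.iso_sym[OF group_integer_group is_isoI] by blast
qed

text \<open>Acyclicity leaves the single group in bidegree \<open>(0, 0)\<close>; the differentials into it and out of it
  have trivial source and target.\<close>

lemma double_cohomology_of_acyclic:
  assumes sc: "simplicial_complex m K"
    and ac: "\<And>I. I \<noteq> {} \<Longrightarrow> I \<subseteq> {1..m} \<Longrightarrow> acyclic_complex (full_subcomplex K I)"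
  shows "(k, l) \<noteq> (0, 0) \<Longrightarrow> trivial_group (double_cohomology m K k l)"
    and "double_cohomology m K 0 0 \<cong> integer_group"
proof -
  note fin = finite_complex_full_subcomplex[OF sc]
  have triv: "trivial_group (bigraded_cohomology m K k l)" if "(k, l) \<noteq> (0, 0)" for k l
  proof (rule trivial_bigraded_cohomology[OF sc])
    fix I assume I: "I \<in> vertex_subsets m l"
    show "trivial_group (reduced_cohomology_group (full_subcomplex K I) (l - k - 1))"
    proof (cases "I = {}")
      case True
      then have "l = 0" using I by (simp add: vertex_subsets_def)
      then show ?thesis
        using that True by (intro trivial_reduced_cohomology_no_faces fin) (simp add: faces_empty_subcomplex[OF sc])
    next
      case False
      then show ?thesis
        using ac I by (auto simp: acyclic_complex_def vertex_subsets_def)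
    qed
  qed
  have image: "double_differential m K (k + 1) (l + 1) ` carrier (bigraded_cohomology m K (k + 1) (l + 1))
      = {\<one>\<^bsub>bigraded_cohomology m K k l\<^esub>}"
    if "trivial_group (bigraded_cohomology m K (k + 1) (l + 1))" for k l
    using that double_differential_one[OF sc, of "k + 1" "l + 1"] by (simp add: trivial_group_def)
  show "trivial_group (double_cohomology m K k l)" if nz: "(k, l) \<noteq> (0, 0)"
  proof -
    have "double_differential m K (k + 1) (l + 1) ` carrier (bigraded_cohomology m K (k + 1) (l + 1))
        = {\<one>\<^bsub>bigraded_cohomology m K k l\<^esub>}"
    proof -
      have "double_differential m K (k + 1) (l + 1) ` carrier (bigraded_cohomology m K (k + 1) (l + 1))
          \<subseteq> carrier (bigraded_cohomology m K k l)"
        using double_differential_closed[OF sc, of _ "k + 1" "l + 1"] by auto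
      moreover have "carrier (bigraded_cohomology m K (k + 1) (l + 1)) \<noteq> {}"
        using group_bigraded_cohomology[OF sc] group.is_monoid monoid.one_closed by blast
      ultimately show ?thesis
        using triv[OF nz] by (simp add: trivial_group_def subset_singleton_iff)
    qed
    then show ?thesis
      unfolding double_cohomology_def by (rule homology_at_trivial_middle[OF triv[OF nz]])
  qed
  have "double_cohomology m K 0 0 \<cong> bigraded_cohomology m K 0 0"
    unfolding double_cohomology_def
  proof (rule homology_at_iso_middle)
    show "double_differential m K (0 + 1) (0 + 1) ` carrier (bigraded_cohomology m K (0 + 1) (0 + 1))
        = {\<one>\<^bsub>bigraded_cohomology m K 0 0\<^esub>}"
      by (rule image) (simp add: triv)
    show "double_differential m K 0 0 x = \<one>\<^bsub>bigraded_cohomology m K (0 - 1) (0 - 1)\<^esub>"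
      if "x \<in> carrier (bigraded_cohomology m K 0 0)" for x
      using double_differential_closed[OF sc that] triv[of "0 - 1" "0 - 1"] by (simp add: trivial_group_def)
  qed (rule group_bigraded_cohomology[OF sc])
  then show "double_cohomology m K 0 0 \<cong> integer_group"
    using iso_trans bigraded_cohomology_zero_iso[OF sc] by blast
qed

section \<open>Simplices are acyclic\<close>

text \<open>The simplex is a cone with apex its least vertex \<open>a\<close>.  Choosing the least vertex makes the sign of \<open>a\<close>
  in every face trivial and shifts the position of all other vertices by one.\<close>

lemma acyclic_simplex:
  assumes "I \<noteq> {}" "finite I"
  shows "acyclic_complex (Pow I)"
  unfolding acyclic_complex_def
proof
  fix p
  have fin: "finite_complex (Pow I)"
    using assms(2) finite_subset by (auto simp: finite_complex_def)
  obtain a where a: "a \<in> I" "\<And>x. x \<in> I \<Longrightarrow> a \<le> x"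
    using Min_in[OF assms(2,1)] Min_le[OF assms(2)] by blast
  show "trivial_group (reduced_cohomology_group (Pow I) p)"
    unfolding trivial_reduced_cohomology_group_iff[OF fin]
  proof (intro allI impI)
    fix f assume f: "cocycle (Pow I) p f"
    define u where "u J = (if a \<in> J then 0 else f (insert a J))" for J
    have sign: "vertex_sign a T = 1" if "T \<subseteq> I" for T
    proof -
      have no: "{r \<in> T. r < a} = {}" using a(2) that by force
      show ?thesis unfolding vertex_sign_def no by simp
    qed
    \<comment> \<open>On faces with apex this is the definition of \<open>u\<close>; on the others it is the cocycle condition at the
      face with the apex added.\<close>
    have "f J = delta u J" if J: "J \<in> faces (Pow I) p" for J
    proof (cases "a \<in> J")
      case True
      have J': "finite J" "J \<subseteq> I"
        using J assms(2) finite_subset by (auto simp: faces_def)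
      have "delta u J = vertex_sign a J * u (J - {a}) + (\<Sum>j\<in>J - {a}. vertex_sign j J * u (J - {j}))"
        unfolding delta_def by (rule sum.remove[OF J'(1) True])
      also have "(\<Sum>j\<in>J - {a}. vertex_sign j J * u (J - {j})) = 0"
        using True by (intro sum.neutral) (auto simp: u_def)
      also have "u (J - {a}) = f J"
        using True by (simp add: u_def insert_absorb)
      finally show ?thesis
        by (simp add: sign J'(2))
    next
      case False
      let ?T = "insert a J"
      have J': "finite J" "J \<subseteq> I"
        using J assms(2) finite_subset by (auto simp: faces_def)
      then have T: "?T \<in> faces (Pow I) (p + 1)"
        using J a(1) False by (simp add: faces_def)
      have "0 = delta f ?T"
        using f T by (simp add: cocycle_def)
      also have "\<dots> = vertex_sign a ?T * f J + (\<Sum>j\<in>J. vertex_sign j ?T * f (?T - {j}))"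
        unfolding delta_def using J'(1) False by (subst sum.insert) auto
      also have "(\<Sum>j\<in>J. vertex_sign j ?T * f (?T - {j})) = - delta u J"
        unfolding delta_def sum_negf[symmetric]
      proof (intro sum.cong refl)
        fix j assume j: "j \<in> J"
        have "?T - {j} = insert a (J - {j})" using j False by auto
        moreover have "vertex_sign j ?T = - vertex_sign j J"
        proof -
          have "a < j" using a(2) j J'(2) False by (metis le_neq_implies_less subsetD)
          then have "{r \<in> ?T. r < j} = insert a {r \<in> J. r < j}" by auto
          then show ?thesis using False J'(1) by (simp add: vertex_sign_def)
        qed
        ultimately show "vertex_sign j ?T * f (?T - {j}) = - (vertex_sign j J * u (J - {j}))"
          using False by (simp add: u_def)
      qed
      finally show ?thesis
        using sign[of ?T] a(1) J'(2) by simp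
    qed
    then show "\<exists>u. \<forall>J\<in>faces (Pow I) p. f J = delta u J"
      by blast
  qed
qed

section \<open>Moment-angle complexes and spheres\<close>

lemma continuous_map_Max:
  assumes "finite A" "A \<noteq> {}" "\<And>i. i \<in> A \<Longrightarrow> continuous_map X euclideanreal (f i)"
  shows "continuous_map X euclideanreal (\<lambda>x. MAX i\<in>A. f i x)"
  using assms
proof (induction A rule: finite_ne_induct)
  case (insert a A)
  then have "(\<lambda>x. MAX i\<in>insert a A. f i x) = (\<lambda>x. max (f a x) (MAX i\<in>A. f i x))"
    by simp
  moreover have "continuous_map X euclideanreal (\<lambda>x. max (f a x) (MAX i\<in>A. f i x))"
    using insert by (intro continuous_map_real_max) auto
  ultimately show ?case by simp
qed simp

lemma sum_lessThan_double:
  fixes h :: "nat \<Rightarrow> 'a::comm_monoid_add"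
  shows "(\<Sum>k<2 * n. h k) = (\<Sum>i<n. h (2 * i) + h (2 * i + 1))"
  by (induction n) (auto simp: add.assoc)

text \<open>A retraction is surjective on homology.\<close>

lemma retraction_map_trivial_homology_group:
  assumes "retraction_map X Y r" "trivial_group (homology_group p X)"
  shows "trivial_group (homology_group p Y)"
proof -
  have "carrier (homology_group p Y) = hom_induced p X {} Y {} r ` {\<one>\<^bsub>homology_group p X\<^esub>}"
    using surj_hom_induced_retraction_map[OF assms(1), of p] assms(2) by (simp add: trivial_group_def)
  then show ?thesis
    by (subst group.trivial_group_alt) auto
qed

text \<open>For a minimal non-face \<open>I\<close>, the points of the moment-angle complex have a coordinate of modulus \<open>1\<close> in
  \<open>I\<close>, so their projection to the coordinates in \<open>I\<close> can be scaled to the Euclidean unit sphere.  The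
  section scales a point of the sphere to maximum norm \<open>1\<close> and puts \<open>1\<close> in the other coordinates; it ends
  in the complex because dropping a coordinate of maximal modulus from \<open>I\<close> leaves a face.\<close>

lemma retraction_map_moment_angle_complex_nsphere:
  assumes sc: "simplicial_complex m K" and I: "I \<subseteq> {1..m}" "I \<notin> K"
    and min: "\<And>J. J \<subset> I \<Longrightarrow> J \<in> K"
  shows "\<exists>r. retraction_map (moment_angle_complex m K) (nsphere (2 * card I - 1)) r"
proof -
  define n where "n = card I"
  have finI: "finite I" using I(1) finite_subset by blast
  have neI: "I \<noteq> {}" using I(2) sc by (auto simp: simplicial_complex_def)
  have n: "0 < n" using finI neI by (simp add: n_def card_gt_0_iff)
  have dim: "k \<le> 2 * n - 1 \<longleftrightarrow> k < 2 * n" for k using n by auto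
  have topS: "topspace (nsphere (2 * n - 1)) = {x. (\<Sum>k<2 * n. (x k)\<^sup>2) = 1 \<and> (\<forall>k\<ge>2 * n. x k = 0)}"
  proof -
    have "{..2 * n - 1} = {..<2 * n}" using dim by auto
    moreover have "2 * n - 1 < k \<longleftrightarrow> k \<ge> 2 * n" for k using n by auto
    ultimately show ?thesis by (simp add: nsphere)
  qed
  \<comment> \<open>The vertex \<open>e i\<close> owns the real coordinates \<open>2 * i\<close> and \<open>2 * i + 1\<close> of the sphere.\<close>
  obtain e where e: "bij_betw e {..<n} I"
    using ex_bij_betw_nat_finite[OF finI] by (auto simp: n_def atLeast0LessThan)
  define e' where "e' = inv_into {..<n} e"
  have e': "e' (e i) = i" if "i < n" for i
    using e that by (simp add: e'_def bij_betw_inv_into_left)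
  have e_in: "e i \<in> I" if "i < n" for i
    using e that by (auto simp: bij_betw_def)
  have sum_I: "(\<Sum>j\<in>I. h j) = (\<Sum>i<n. h (e i))" for h :: "nat \<Rightarrow> real"
    by (rule sum.reindex_bij_betw[OF e, symmetric])
  \<comment> \<open>\<open>N\<close> is the Euclidean and \<open>M\<close> the maximum norm of the coordinates in \<open>I\<close>; \<open>r\<close> is the retraction
    and \<open>s\<close> its section.\<close>
  define N where "N z = sqrt (\<Sum>j\<in>I. (Re (z j))\<^sup>2 + (Im (z j))\<^sup>2)" for z :: "nat \<Rightarrow> complex"
  define r where "r z k = (if k < 2 * n then (if even k then Re (z (e (k div 2))) else Im (z (e (k div 2)))) / N z else 0)"
    for z k
  define w where "w x j = Complex (x (2 * e' j)) (x (2 * e' j + 1))" for x :: "nat \<Rightarrow> real" and j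
  define M where "M x = (MAX j\<in>I. norm (w x j))" for x
  define s where "s x = (\<lambda>j\<in>{1..m}. if j \<in> I then Complex (x (2 * e' j) / M x) (x (2 * e' j + 1) / M x) else 1)" for x
  let ?Z = "moment_angle_complex m K" and ?S = "nsphere (2 * n - 1)"
  have topZ: "topspace ?Z = moment_angle_set m K"
    by (auto simp: moment_angle_complex_def moment_angle_set_def)
  have Npos: "N z > 0" if z: "z \<in> moment_angle_set m K" for z
  proof -
    obtain J where J: "J \<in> K" "\<forall>j\<in>{1..m} - J. norm (z j) = 1"
      using z by (auto simp: moment_angle_set_def)
    have "\<not> I \<subseteq> J" using J(1) I(2) sc by (auto simp: simplicial_complex_def)
    then obtain j where j: "j \<in> I" "norm (z j) = 1" using J(2) I(1) by blast
    have "0 < (Re (z j))\<^sup>2 + (Im (z j))\<^sup>2"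
      using j(2) by (simp add: cmod_def)
    also have "\<dots> \<le> (\<Sum>j\<in>I. (Re (z j))\<^sup>2 + (Im (z j))\<^sup>2)"
      using finI j(1) by (intro member_le_sum) auto
    finally show ?thesis by (simp add: N_def)
  qed
  have "continuous_map ?Z ?S r"
    unfolding nsphere continuous_map_in_subtopology continuous_map_componentwise_UNIV
  proof (intro conjI allI)
    fix k
    have coord: "continuous_map ?Z euclidean (\<lambda>z. z j)" if "j \<in> {1..m}" for j
      unfolding moment_angle_complex_def
      by (rule continuous_map_from_subtopology[OF continuous_map_product_projection[OF that]])
    have Re: "continuous_map ?Z euclideanreal (\<lambda>z. Re (z j))" if "j \<in> {1..m}" for j
      using coord[OF that] by (simp add: continuous_map_atin tendsto_Re)
    have Im: "continuous_map ?Z euclideanreal (\<lambda>z. Im (z j))" if "j \<in> {1..m}" for j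
      using coord[OF that] by (simp add: continuous_map_atin tendsto_Im)
    have N: "continuous_map ?Z euclideanreal N"
      unfolding N_def using Re Im I(1) finI
      by (intro continuous_map_sqrt continuous_map_sum continuous_map_add continuous_map_real_pow) auto
    have Nnz: "N z \<noteq> 0" if "z \<in> topspace ?Z" for z
      using Npos[of z] that topZ by simp
    show "continuous_map ?Z euclideanreal (\<lambda>z. r z k)"
    proof (cases "k < 2 * n")
      case True
      then have "k div 2 < n" by auto
      then have "e (k div 2) \<in> {1..m}" using e_in I(1) by blast
      then show ?thesis
        using True Nnz unfolding r_def
        by (cases "even k") (auto intro!: continuous_map_real_divide Re Im N)
    qed (simp add: r_def)
  next
    have "r z \<in> topspace ?S" if "z \<in> moment_angle_set m K" for z
    proof -
      have "(\<Sum>k<2 * n. (r z k)\<^sup>2) = (\<Sum>i<n. ((Re (z (e i)))\<^sup>2 + (Im (z (e i)))\<^sup>2) / (N z)\<^sup>2)"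
        unfolding sum_lessThan_double by (intro sum.cong refl) (simp add: r_def power_divide add_divide_distrib)
      also have "\<dots> = (\<Sum>j\<in>I. (Re (z j))\<^sup>2 + (Im (z j))\<^sup>2) / (N z)\<^sup>2"
        unfolding sum_I by (simp add: sum_divide_distrib)
      also have "(\<Sum>j\<in>I. (Re (z j))\<^sup>2 + (Im (z j))\<^sup>2) = (N z)\<^sup>2"
        by (simp add: N_def sum_nonneg)
      finally have "(\<Sum>k<2 * n. (r z k)\<^sup>2) = 1"
        using Npos[OF that] by simp
      moreover have "\<forall>k\<ge>2 * n. r z k = 0"
        by (simp add: r_def)
      ultimately show ?thesis
        unfolding topS by blast
    qed
    then show "r \<in> topspace ?Z \<rightarrow> {x. (\<Sum>i\<le>2 * n - 1. (x i)\<^sup>2) = 1 \<and> (\<forall>i>2 * n - 1. x i = 0)}"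
      unfolding topZ by (auto simp: nsphere)
  qed
  moreover
  have sumw: "(\<Sum>j\<in>I. (norm (w x j))\<^sup>2) = 1" if "x \<in> topspace ?S" for x
  proof -
    have "(\<Sum>j\<in>I. (norm (w x j))\<^sup>2) = (\<Sum>i<n. (x (2 * i))\<^sup>2 + (x (2 * i + 1))\<^sup>2)"
      unfolding sum_I by (intro sum.cong refl) (simp add: w_def e' cmod_def)
    then show ?thesis
      using that unfolding topS sum_lessThan_double by simp
  qed
  have M: "norm (w x j) \<le> M x" if "j \<in> I" for x j
    unfolding M_def using finI that by (intro Max_ge) auto
  have M_attained: "\<exists>j\<in>I. norm (w x j) = M x" for x
  proof -
    have "M x \<in> (\<lambda>j. norm (w x j)) ` I"
      unfolding M_def using finI neI by (intro Max_in) auto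
    then show ?thesis by auto
  qed
  have Mpos: "M x > 0" if "x \<in> topspace ?S" for x
  proof (rule ccontr)
    assume "\<not> M x > 0"
    then have "norm (w x j) = 0" if "j \<in> I" for j
      using M[OF that, of x] norm_ge_zero[of "w x j"] by linarith
    then show False using sumw[OF that] by simp
  qed
  have norm_s: "norm (s x j) = norm (w x j) / M x" if "x \<in> topspace ?S" "j \<in> I" for x j
  proof -
    have "s x j = w x j / of_real (M x)"
      using that(2) I(1) by (auto simp: s_def w_def complex_eq_iff Re_divide_of_real Im_divide_of_real)
    then show ?thesis using Mpos[OF that(1)] by (simp add: norm_divide)
  qed
  have "continuous_map ?S ?Z s"
    unfolding moment_angle_complex_def continuous_map_in_subtopology continuous_map_componentwise
  proof (intro conjI ballI)
    show "s ` topspace ?S \<subseteq> extensional {1..m}"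
      by (auto simp: s_def)
    have M_cont: "continuous_map ?S euclideanreal M"
      unfolding M_def w_def
    proof (rule continuous_map_Max[OF finI neI])
      fix j
      show "continuous_map ?S euclideanreal (\<lambda>x. norm (Complex (x (2 * e' j)) (x (2 * e' j + 1))))"
        unfolding cmod_def complex.sel
        by (intro continuous_map_sqrt continuous_map_add continuous_map_real_pow continuous_map_nsphere_projection)
    qed
    fix j assume j: "j \<in> {1..m}"
    show "continuous_map ?S euclidean (\<lambda>x. s x j)"
    proof (cases "j \<in> I")
      case True
      have "continuous_map ?S euclideanreal (\<lambda>x. x k / M x)" for k
        by (intro continuous_map_real_divide continuous_map_nsphere_projection M_cont) (use Mpos in force)
      then have "continuous_map ?S euclidean (\<lambda>x. Complex (x (2 * e' j) / M x) (x (2 * e' j + 1) / M x))"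
        by (simp add: continuous_map_atin tendsto_Complex)
      then show ?thesis using True j by (simp add: s_def)
    qed (use j in \<open>simp add: s_def\<close>)
  next
    show "s \<in> topspace ?S \<rightarrow> moment_angle_set m K"
    proof
      fix x assume x: "x \<in> topspace ?S"
      obtain j where j: "j \<in> I" "norm (w x j) = M x" using M_attained by blast
      have "I - {j} \<in> K" using min[of "I - {j}"] j(1) by auto
      moreover have "s x \<in> {1..m} \<rightarrow>\<^sub>E cball 0 1"
      proof (rule PiE_I)
        fix i assume "i \<in> {1..m}"
        then show "s x i \<in> cball 0 1"
          using norm_s[OF x, of i] M[of i x] Mpos[OF x] by (cases "i \<in> I") (auto simp: s_def)
      qed (auto simp: s_def)
      moreover have "norm (s x i) = 1" if "i \<in> {1..m} - (I - {j})" for i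
        using that norm_s[OF x j(1)] j(2) Mpos[OF x] by (cases "i = j") (auto simp: s_def)
      ultimately show "s x \<in> moment_angle_set m K"
        unfolding moment_angle_set_def by blast
    qed
  qed
  moreover have "r (s x) = x" if x: "x \<in> topspace ?S" for x
  proof
    fix k
    have "(\<Sum>j\<in>I. (Re (s x j))\<^sup>2 + (Im (s x j))\<^sup>2) = (\<Sum>j\<in>I. (norm (w x j))\<^sup>2 / (M x)\<^sup>2)"
      using norm_s[OF x] by (intro sum.cong refl) (simp add: power_divide flip: cmod_power2)
    also have "\<dots> = 1 / (M x)\<^sup>2"
      using sumw[OF x] by (simp flip: sum_divide_distrib)
    finally have N: "N (s x) = 1 / M x"
      using Mpos[OF x] by (simp add: N_def real_sqrt_divide)
    show "r (s x) k = x k"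
    proof (cases "k < 2 * n")
      case True
      then have "k div 2 < n" by auto
      then have "s x (e (k div 2)) = Complex (x (2 * (k div 2)) / M x) (x (2 * (k div 2) + 1) / M x)"
        using e_in[of "k div 2"] I(1) by (auto simp: s_def e')
      moreover have "2 * (k div 2) = (if even k then k else k - 1)" "odd k \<Longrightarrow> k - 1 + 1 = k"
        by (auto elim: oddE)
      ultimately show ?thesis
        using True Mpos[OF x] by (auto simp: r_def N)
    next
      case False
      then have "x k = 0" using x unfolding topS by auto
      then show ?thesis using False by (simp add: r_def)
    qed
  qed
  ultimately show ?thesis
    unfolding retraction_map_def retraction_maps_def n_def by blast
qed

lemma full_simplex_if_acyclic_moment_angle_complex:
  assumes sc: "simplicial_complex m K" and ac: "acyclic_space (moment_angle_complex m K)"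
  shows "K = Pow {1..m}"
proof (rule ccontr)
  assume "K \<noteq> Pow {1..m}"
  then have "{1..m} \<notin> K"
    using sc by (auto simp: simplicial_complex_def)
  define P where "P I \<longleftrightarrow> I \<subseteq> {1..m} \<and> I \<notin> K" for I
  have "P {1..m}" using \<open>{1..m} \<notin> K\<close> by (simp add: P_def)
  from ex_has_least_nat[of P, OF this, of card] obtain I where I: "P I" "\<And>J. P J \<Longrightarrow> card I \<le> card J"
    by blast
  have finI: "finite I" using I(1) finite_subset[of I "{1..m}"] by (simp add: P_def)
  have "J \<in> K" if "J \<subset> I" for J
    using I(2)[of J] psubset_card_mono[OF finI that] that I(1) by (auto simp: P_def)
  then obtain r where r: "retraction_map (moment_angle_complex m K) (nsphere (2 * card I - 1)) r"
    using retraction_map_moment_angle_complex_nsphere[OF sc, of I] I(1) unfolding P_def by blast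
  have "I \<noteq> {}" using I(1) sc by (auto simp: P_def simplicial_complex_def)
  then have "0 < card I" using finI by (simp add: card_gt_0_iff)
  then have pos: "int (2 * card I - 1) \<noteq> 0" by linarith
  have "trivial_group (reduced_homology_group (int (2 * card I - 1)) (moment_angle_complex m K))"
    using ac unfolding acyclic_space_def by blast
  then have "trivial_group (homology_group (int (2 * card I - 1)) (moment_angle_complex m K))"
    by (simp only: un_reduced_homology_group[OF pos])
  from retraction_map_trivial_homology_group[OF r this]
  have "trivial_group (reduced_homology_group (int (2 * card I - 1)) (nsphere (2 * card I - 1)))"
    by (simp only: un_reduced_homology_group[OF pos])
  then show False
    by (simp only: trivial_reduced_homology_group_nsphere)
qed

lemma moment_angle_set_full_simplex:
  "moment_angle_set m (Pow {1..m}) = ({1..m} \<rightarrow>\<^sub>E cball 0 1)"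
  by (auto simp: moment_angle_set_def)

lemma acyclic_moment_angle_complex_full_simplex:
  "acyclic_space (moment_angle_complex m (Pow {1..m}))"
proof -
  have eq: "moment_angle_complex m (Pow {1..m}) = product_topology (\<lambda>_. top_of_set (cball 0 1)) {1..m}"
    unfolding moment_angle_complex_def moment_angle_set_full_simplex by (rule subtopology_product_topology)
  have "contractible_space (moment_angle_complex m (Pow {1..m}))"
    unfolding eq contractible_space_product_topology by (simp add: convex_imp_contractible)
  moreover have "(\<lambda>j\<in>{1..m}. 0) \<in> topspace (moment_angle_complex m (Pow {1..m}))"
    unfolding eq by simp
  ultimately show ?thesis
    unfolding acyclic_space_def using trivial_reduced_homology_group_contractible_space by blast
qed

section \<open>Equivalence of the four conditions\<close>

theorem proposition6p1:
  fixes m :: nat and K :: "nat set set"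
  assumes "m \<ge> 1" and "simplicial_complex m K"
  shows
    "((\<forall>I. I \<noteq> {} \<and> I \<subseteq> {1..m} \<longrightarrow> acyclic_complex (full_subcomplex K I))
        \<longleftrightarrow> (K = Pow {1..m} \<and> moment_angle_set m K = ({1..m} \<rightarrow>\<^sub>E cball 0 1)))
     \<and> ((K = Pow {1..m} \<and> moment_angle_set m K = ({1..m} \<rightarrow>\<^sub>E cball 0 1))
        \<longleftrightarrow> acyclic_space (moment_angle_complex m K))
     \<and> (acyclic_space (moment_angle_complex m K)
        \<longleftrightarrow> ((\<forall>k l. (k, l) \<noteq> (0, 0) \<longrightarrow> trivial_group (double_cohomology m K k l))
             \<and> double_cohomology m K 0 0 \<cong> integer_group))"
proof -
  let ?a = "\<forall>I. I \<noteq> {} \<and> I \<subseteq> {1..m} \<longrightarrow> acyclic_complex (full_subcomplex K I)"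
  let ?b = "K = Pow {1..m} \<and> moment_angle_set m K = ({1..m} \<rightarrow>\<^sub>E cball 0 1)"
  let ?c = "acyclic_space (moment_angle_complex m K)"
  let ?d = "(\<forall>k l. (k, l) \<noteq> (0, 0) \<longrightarrow> trivial_group (double_cohomology m K k l))
             \<and> double_cohomology m K 0 0 \<cong> integer_group"
  note sc = \<open>simplicial_complex m K\<close>
  have simplex: "?b \<longleftrightarrow> K = Pow {1..m}"
    by (rule iffI, erule conjunct1, simp only: moment_angle_set_full_simplex)
  have d: ?d if ?a
  proof -
    have "acyclic_complex (full_subcomplex K I)" if "I \<noteq> {}" "I \<subseteq> {1..m}" for I
      using \<open>?a\<close> that by simp
    note double = double_cohomology_of_acyclic[OF sc this]
    show ?d
      by (intro conjI allI impI double)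
  qed
  have simplex_d: "K = Pow {1..m}" if ?d
  proof (rule full_simplex_if_double_cohomology_trivial[OF sc \<open>m \<ge> 1\<close>])
    show "trivial_group (double_cohomology m K 1 l)" for l
      using that by simp
  qed
  have a: ?a if "K = Pow {1..m}"
  proof (intro allI impI)
    fix I assume I: "I \<noteq> {} \<and> I \<subseteq> {1..m}"
    then have "full_subcomplex K I = Pow I"
      using that by (auto simp: full_subcomplex_def)
    then show "acyclic_complex (full_subcomplex K I)"
      using acyclic_simplex[of I] I finite_subset[of I "{1..m}"] by simp
  qed
  have c: "?c \<longleftrightarrow> K = Pow {1..m}"
    by (rule iffI, erule full_simplex_if_acyclic_moment_angle_complex[OF sc],
        simp only: acyclic_moment_angle_complex_full_simplex)
  have a_iff: "?a \<longleftrightarrow> K = Pow {1..m}"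
    by (rule iffI) (erule simplex_d[OF d], erule a)
  have d_iff: "K = Pow {1..m} \<longleftrightarrow> ?d"
    by (rule iffI) (erule d[OF a], erule simplex_d)
  show ?thesis
    unfolding simplex c by (intro conjI refl a_iff d_iff)
qed

end
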